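(* The assignment $T_j\mapsto \hat T_j$ ($j=0,\ldots,n$) and $T_u\mapsto u$ ($u\in\Omega$, acting on $C(P)$ by $(uf)(\lambda)=f(u^{-1}\lambda)$) extends uniquely to a representation $h\mapsto \hat T(h)$ of the extended affine Hecke algebra $\mathcal H$ on $C(P)$ (i.e. to a unital algebra homomorphism $\mathcal H\to\operatorname{End}(C(P))$).
   Context: Let $R$ be an irreducible reduced crystallographic root system of rank $n$ spanning a real Euclidean space $V$ with inner product $\langle\cdot,\cdot\rangle$; $\alpha^\vee:=2\alpha/\langle\alpha,\alpha\rangle$; $P:=\{\lambda\in V:\langle\lambda,\alpha^\vee\rangle\in\mathbb Z\ \forall\alpha\in R\}$ is the weight lattice. Fix positive roots $R^+$ with simple roots $\alpha_1,\dots,\alpha_n$, and put $R^-:=-R^+$, $P^+:=\{\lambda\in P:\langle\lambda,\alpha^\vee\rangle\ge0\ \forall\alpha\in R^+\}$, $A:=\{x\in V:0<\langle x,\alpha^\vee\rangle<1\ \forall\alpha\in R^+\}$ (the alcove). Let $\alpha_0\in R^+$ be the root such that $\alpha_0^\vee$ is the highest root of $R^\vee$. For $\alpha\in R$, $k\in\mathbb Z$, $s_{\alpha,k}$ is the orthogonal reflection in the hyperplane $V_{\alpha,k}:=\{x:\langle x,\alpha^\vee\rangle=k\}$, $s_\alpha:=s_{\alpha,0}$, and $t_\lambda(x):=x+\lambda$. $W_0$ is the finite Weyl group (generated by the $s_\alpha$) and $W$ the extended affine Weyl group generated by $W_0$ and the $t_\lambda$, $\lambda\in P$. Put $s_0:=s_{\alpha_0,1}$,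 $s_j:=s_{\alpha_j,0}$ ($1\le j\le n$), and let $V_j$ be the hyperplane fixed by $s_j$. The length $\ell(w)$ of $w\in W$ is the number of hyperplanes $V_{\alpha,k}$ separating $A$ and $wA$; $\Omega:=\{u\in W: uA=A\}$; $W$ is generated by $\Omega$ and $s_0,\dots,s_n$. Parameters: $q:W\to\mathbb R\setminus\{0\}$ is length multiplicative ($q_{ww'}=q_wq_{w'}$ whenever $\ell(ww')=\ell(w)+\ell(w')$, and $q_w=1$ if $\ell(w)=0$); $q_j:=q_{s_j}$. The extended affine Hecke algebra $\mathcal H$ is the complex associative algebra with basis $T_w$ ($w\in W$) subject to $(T_j-q_j)(T_j+q_j^{-1})=0$ ($T_j:=T_{s_j}$, $0\le j\le n$) and $T_{ww'}=T_wT_{w'}$ whenever $\ell(ww')=\ell(w)+\ell(w')$; it is generated by $T_0,\dots,T_n$ and $T_u$, $u\in\Omega$. $C(P)$ denotes the space of all functions $P\to\mathbb C$, on which $W$ acts by $(wf)(\lambda):=f(w^{-1}\lambda)$. The difference-reflection operators are $\hat T_j:=q_j+\chi_j(s_j-1)$ ($0\le j\le n$), where $\chi_j$ acts by multiplication with the function $\chi_j(\lambda)=q_j$ if $V_j$ separates $\lambda$ and $A$, $\chi_j(\lambda)=1$ if $\lambda\in V_j$, and $\chi_j(\lambda)=q_j^{-1}$ otherwise. *)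

theory Defs
  imports "HOL-Analysis.Analysis"
begin

definition coroot :: "'a::euclidean_space \<Rightarrow> 'a" where
  "coroot a = (2 / (a \<bullet> a)) *\<^sub>R a"

definition refl_aff :: "'a::euclidean_space \<Rightarrow> int \<Rightarrow> 'a \<Rightarrow> 'a" where
  "refl_aff a k x = x - ((x \<bullet> coroot a) - of_int k) *\<^sub>R a"

definition hyperpl :: "'a::euclidean_space \<Rightarrow> int \<Rightarrow> 'a set" where
  "hyperpl a k = {x. x \<bullet> coroot a = of_int k}"

definition transl :: "'a::euclidean_space \<Rightarrow> 'a \<Rightarrow> 'a" where
  "transl l x = x + l"

definition weight_lattice :: "'a::euclidean_space set \<Rightarrow> 'a set" where
  "weight_lattice R = {l. \<forall>a\<in>R. l \<bullet> coroot a \<in> \<int>}"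

definition root_system :: "'a::euclidean_space set \<Rightarrow> bool" where
  "root_system R \<longleftrightarrow>
     finite R \<and> 0 \<notin> R \<and> span R = UNIV \<and>
     (\<forall>a\<in>R. \<forall>b\<in>R. refl_aff a 0 b \<in> R) \<and>
     (\<forall>a\<in>R. \<forall>b\<in>R. b \<bullet> coroot a \<in> \<int>) \<and>
     (\<forall>a\<in>R. \<forall>c::real. c *\<^sub>R a \<in> R \<longrightarrow> c = 1 \<or> c = -1) \<and>
     \<not> (\<exists>R1 R2. R1 \<noteq> {} \<and> R2 \<noteq> {} \<and> R1 \<union> R2 = R \<and>
            (\<forall>a\<in>R1. \<forall>b\<in>R2. a \<bullet> b = 0))"

definition is_base :: "'a::euclidean_space set \<Rightarrow> 'a set \<Rightarrow> bool" where
  "is_base R S \<longleftrightarrow> S \<subseteq> R \<and> independent S \<and>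
     (\<forall>b\<in>R. \<exists>c :: 'a \<Rightarrow> int. b = (\<Sum>a\<in>S. of_int (c a) *\<^sub>R a) \<and>
                 ((\<forall>a\<in>S. c a \<ge> 0) \<or> (\<forall>a\<in>S. c a \<le> 0)))"

definition pos_roots :: "'a::euclidean_space set \<Rightarrow> 'a set \<Rightarrow> 'a set" where
  "pos_roots R S = {b\<in>R. \<exists>c :: 'a \<Rightarrow> int. b = (\<Sum>a\<in>S. of_int (c a) *\<^sub>R a) \<and> (\<forall>a\<in>S. c a \<ge> 0)}"

definition alcove :: "'a::euclidean_space set \<Rightarrow> 'a set \<Rightarrow> 'a set" where
  "alcove R S = {x. \<forall>a\<in>pos_roots R S. 0 < x \<bullet> coroot a \<and> x \<bullet> coroot a < 1}"

definition highest_coroot_root :: "'a::euclidean_space set \<Rightarrow> 'a set \<Rightarrow> 'a \<Rightarrow> bool" where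
  "highest_coroot_root R S a0 \<longleftrightarrow> a0 \<in> pos_roots R S \<and>
     (\<forall>b\<in>R. \<exists>c :: 'a \<Rightarrow> int. (\<forall>a\<in>S. c a \<ge> 0) \<and>
         coroot a0 - coroot b = (\<Sum>a\<in>S. of_int (c a) *\<^sub>R coroot a))"

inductive_set ext_weyl :: "'a::euclidean_space set \<Rightarrow> ('a \<Rightarrow> 'a) set" for R where
  ew_id: "id \<in> ext_weyl R"
| ew_refl: "w \<in> ext_weyl R \<Longrightarrow> a \<in> R \<Longrightarrow> refl_aff a 0 \<circ> w \<in> ext_weyl R"
| ew_transl: "w \<in> ext_weyl R \<Longrightarrow> l \<in> weight_lattice R \<Longrightarrow> transl l \<circ> w \<in> ext_weyl R"

definition separates :: "'a::euclidean_space \<Rightarrow> int \<Rightarrow> 'a set \<Rightarrow> 'a set \<Rightarrow> bool" where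
  "separates a k X Y \<longleftrightarrow>
     ((\<forall>x\<in>X. x \<bullet> coroot a < of_int k) \<and> (\<forall>y\<in>Y. y \<bullet> coroot a > of_int k)) \<or>
     ((\<forall>x\<in>X. x \<bullet> coroot a > of_int k) \<and> (\<forall>y\<in>Y. y \<bullet> coroot a < of_int k))"

definition len :: "'a::euclidean_space set \<Rightarrow> 'a set \<Rightarrow> ('a \<Rightarrow> 'a) \<Rightarrow> nat" where
  "len R S w = card {H. \<exists>a\<in>R. \<exists>k::int. H = hyperpl a k \<and>
                        separates a k (alcove R S) (w ` alcove R S)}"

definition Omega :: "'a::euclidean_space set \<Rightarrow> 'a set \<Rightarrow> ('a \<Rightarrow> 'a) set" where
  "Omega R S = {u\<in>ext_weyl R. u ` alcove R S = alcove R S}"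

text \<open>Index set of the affine simple reflections: j = (a,k) stands for s_j = s_{a,k};
  j = 0 is (a0,1), and j = 1..n are (a_j,0) for the simple roots a_j in S.\<close>
definition aff_simple :: "'a::euclidean_space set \<Rightarrow> 'a \<Rightarrow> ('a \<times> int) set" where
  "aff_simple S a0 = insert (a0, 1) ((\<lambda>a. (a, 0)) ` S)"

text \<open>C(P): functions P -> complex, represented as functions on V vanishing off P.\<close>
definition CP :: "'a::euclidean_space set \<Rightarrow> ('a \<Rightarrow> complex) set" where
  "CP R = {f. \<forall>x. x \<notin> weight_lattice R \<longrightarrow> f x = 0}"

definition chi :: "'a::euclidean_space set \<Rightarrow> 'a set \<Rightarrow> (('a \<Rightarrow> 'a) \<Rightarrow> real)
                    \<Rightarrow> 'a \<times> int \<Rightarrow> 'a \<Rightarrow> real" where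
  "chi R S q j l = (let qj = q (refl_aff (fst j) (snd j)) in
     if separates (fst j) (snd j) {l} (alcove R S) then qj
     else if l \<in> hyperpl (fst j) (snd j) then 1
     else inverse qj)"

definition hatT :: "'a::euclidean_space set \<Rightarrow> 'a set \<Rightarrow> (('a \<Rightarrow> 'a) \<Rightarrow> real)
                    \<Rightarrow> 'a \<times> int \<Rightarrow> ('a \<Rightarrow> complex) \<Rightarrow> ('a \<Rightarrow> complex)" where
  "hatT R S q j f = (\<lambda>l. complex_of_real (q (refl_aff (fst j) (snd j))) * f l
      + complex_of_real (chi R S q j l) * (f (refl_aff (fst j) (snd j) l) - f l))"

definition W_act :: "('a \<Rightarrow> 'a) \<Rightarrow> ('a \<Rightarrow> complex) \<Rightarrow> ('a \<Rightarrow> complex)" where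
  "W_act u f = (\<lambda>l. f (inv u l))"

text \<open>The extended affine Hecke algebra H is presented by the basis T_w (w in W) with the
  relations T_{ww'} = T_w T_{w'} for l(ww') = l(w)+l(w') and (T_j - q_j)(T_j + q_j^{-1}) = 0.
  By this presentation, a unital algebra homomorphism H -> End(C(P)) is the same thing as
  an assignment phi : W -> End(C(P)) (phi w = image of T_w) of linear operators satisfying
  these defining relations.\<close>
definition hecke_rep :: "'a::euclidean_space set \<Rightarrow> 'a set \<Rightarrow> 'a \<Rightarrow> (('a \<Rightarrow> 'a) \<Rightarrow> real)
      \<Rightarrow> (('a \<Rightarrow> 'a) \<Rightarrow> ('a \<Rightarrow> complex) \<Rightarrow> ('a \<Rightarrow> complex)) \<Rightarrow> bool" where
  "hecke_rep R S a0 q \<phi> \<longleftrightarrow>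
     (\<forall>w\<in>ext_weyl R. \<forall>f\<in>CP R. \<phi> w f \<in> CP R) \<and>
     (\<forall>w\<in>ext_weyl R. \<forall>f\<in>CP R. \<forall>g\<in>CP R. \<forall>c::complex.
         \<phi> w (\<lambda>x. c * f x + g x) = (\<lambda>x. c * \<phi> w f x + \<phi> w g x)) \<and>
     (\<forall>f\<in>CP R. \<phi> id f = f) \<and>
     (\<forall>w\<in>ext_weyl R. \<forall>w'\<in>ext_weyl R. len R S (w \<circ> w') = len R S w + len R S w' \<longrightarrow>
         (\<forall>f\<in>CP R. \<phi> (w \<circ> w') f = \<phi> w (\<phi> w' f))) \<and>
     (\<forall>j\<in>aff_simple S a0. \<forall>f\<in>CP R.
         (let s = refl_aff (fst j) (snd j); qj = complex_of_real (q s);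
              g = (\<lambda>x. \<phi> s f x + inverse qj * f x)
          in \<phi> s g = (\<lambda>x. qj * g x)))"

definition extends_assignment :: "'a::euclidean_space set \<Rightarrow> 'a set \<Rightarrow> 'a \<Rightarrow> (('a \<Rightarrow> 'a) \<Rightarrow> real)
      \<Rightarrow> (('a \<Rightarrow> 'a) \<Rightarrow> ('a \<Rightarrow> complex) \<Rightarrow> ('a \<Rightarrow> complex)) \<Rightarrow> bool" where
  "extends_assignment R S a0 q \<phi> \<longleftrightarrow>
     (\<forall>j\<in>aff_simple S a0. \<forall>f\<in>CP R. \<phi> (refl_aff (fst j) (snd j)) f = hatT R S q j f) \<and>
     (\<forall>u\<in>Omega R S. \<forall>f\<in>CP R. \<phi> u f = W_act u f)"

end

theory Submission
  imports Defs
begin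

text \<open>
  On functions on the group \<open>W\<close> the left difference-reflection operators commute with their right-handed
  analogues, because \<open>w\<close> and \<open>w t\<close> lie on different sides of the wall of \<open>s\<close> only when
  \<open>s w = w t\<close>. The inverse operator of a reduced word for \<open>w\<close>, evaluated at the identity, returns
  \<open>F w / q w\<close>; with the commuting right operators this determines it everywhere, so it depends on
  \<open>w\<close> only. No braid relation has to be checked.

  For a point \<open>y\<close> of the closed alcove, restriction to the orbit, \<open>f \<mapsto> (v \<mapsto> f (v y))\<close>, intertwines the
  operators on functions on the ambient space with those on functions on \<open>W\<close>. Every point lies on
  such an orbit, so all relations carry over.
\<close>

section \<open>Groups with a length function\<close>

text \<open>The inverses enter because the two branches of \<open>left_op s\<close> are unlike:
  where \<open>s\<close> raises the length, it mixes two values of \<open>F\<close>, so a word of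
  such operators evaluated at the identity is a long sum that visibly depends on the word.
  Subtracting the scalar \<open>q s - inverse (q s)\<close> turns \<open>left_op s\<close> into its
  inverse and removes exactly that second term; the inverse word operator then climbs the reduced
  word and reads off a single value. In general the group is larger than the one generated by the
  simple reflections, so a word carries a factor of length zero at its right end. A point of a wall
  has a nontrivial stabiliser, hence \<open>v \<mapsto> f (v y)\<close> is not an arbitrary function
  on the group. This causes no extension problem: the relations hold for all functions on the group
  and are only pulled back.\<close>

definition comp_list :: "('a \<Rightarrow> 'a) list \<Rightarrow> ('a \<Rightarrow> 'a) \<Rightarrow> 'a \<Rightarrow> 'a" where
  "comp_list ss w = foldr (\<circ>) ss w"

lemma comp_list_Nil [simp]: "comp_list [] w = w"
  by (simp add: comp_list_def)

lemma comp_list_Cons: "comp_list (s # ss) w = s \<circ> comp_list ss w"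
  by (simp add: comp_list_def fun_eq_iff)

text \<open>An extended Coxeter group seen through its length alone: \<open>descent\<close> and
  \<open>folding\<close> take the place of a presentation by braid relations. The generator axioms
  concern left multiplication; their right-handed forms come from passing to inverses.\<close>

locale hecke_group =
  fixes W Sg :: "('a \<Rightarrow> 'a) set" and ell :: "('a \<Rightarrow> 'a) \<Rightarrow> nat" and q :: "('a \<Rightarrow> 'a) \<Rightarrow> 'k::field"
  assumes id_in: "id \<in> W"
    and comp_in: "\<And>v w. v \<in> W \<Longrightarrow> w \<in> W \<Longrightarrow> v \<circ> w \<in> W"
    and bij_in: "\<And>w. w \<in> W \<Longrightarrow> bij w"
    and inv_in: "\<And>w. w \<in> W \<Longrightarrow> inv w \<in> W"
    and ell_id: "ell id = 0"
    and ell_inv: "\<And>w. w \<in> W \<Longrightarrow> ell (inv w) = ell w"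
    and ell_comp_le: "\<And>v w. v \<in> W \<Longrightarrow> w \<in> W \<Longrightarrow> ell (v \<circ> w) \<le> ell v + ell w"
    and gen_in: "\<And>s. s \<in> Sg \<Longrightarrow> s \<in> W"
    and gen_gen: "\<And>s. s \<in> Sg \<Longrightarrow> s \<circ> s = id"
    and ell_gen_comp: "\<And>s w. s \<in> Sg \<Longrightarrow> w \<in> W \<Longrightarrow>
      ell (s \<circ> w) = Suc (ell w) \<or> ell w = Suc (ell (s \<circ> w))"
    and descent: "\<And>w. w \<in> W \<Longrightarrow> ell w \<noteq> 0 \<Longrightarrow> \<exists>s\<in>Sg. ell (s \<circ> w) < ell w"
    and folding: "\<And>s t w. s \<in> Sg \<Longrightarrow> t \<in> Sg \<Longrightarrow> w \<in> W \<Longrightarrow> ell w < ell (s \<circ> w) \<Longrightarrow>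
      ell (s \<circ> (w \<circ> t)) < ell (w \<circ> t) \<Longrightarrow> s \<circ> w = w \<circ> t"
    and q_nonzero: "\<And>w. w \<in> W \<Longrightarrow> q w \<noteq> 0"
    and q_comp: "\<And>v w. v \<in> W \<Longrightarrow> w \<in> W \<Longrightarrow> ell (v \<circ> w) = ell v + ell w \<Longrightarrow> q (v \<circ> w) = q v * q w"
    and q_len0: "\<And>w. w \<in> W \<Longrightarrow> ell w = 0 \<Longrightarrow> q w = 1"
begin

section \<open>Lengths and parameters under multiplication by a generator\<close>

lemma gen_cancel: "s \<in> Sg \<Longrightarrow> s \<circ> (s \<circ> w) = w"
  by (metis comp_assoc gen_gen id_comp)

lemma gen_cancel_right: "s \<in> Sg \<Longrightarrow> w \<circ> s \<circ> s = w"
  by (metis comp_assoc gen_gen comp_id)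

lemma inv_gen: "s \<in> Sg \<Longrightarrow> inv s = s"
  using gen_gen inv_unique_comp by blast

lemma ell_gen: "s \<in> Sg \<Longrightarrow> ell s = 1"
  using ell_gen_comp[of s id] id_in ell_id by auto

lemma inv_comp: "v \<in> W \<Longrightarrow> w \<in> W \<Longrightarrow> inv (v \<circ> w) = inv w \<circ> inv v"
  by (simp add: bij_in o_inv_distrib)

lemma inv_cancel: "w \<in> W \<Longrightarrow> inv w \<circ> w = id" "w \<in> W \<Longrightarrow> w \<circ> inv w = id"
  by (simp_all add: bij_in bij_is_inj surj_iff[THEN iffD1] bij_is_surj)

lemma inv_cancel_comp: "w \<in> W \<Longrightarrow> inv w \<circ> (w \<circ> v) = v" "w \<in> W \<Longrightarrow> w \<circ> (inv w \<circ> v) = v"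
  by (simp_all add: comp_assoc[symmetric] inv_cancel)

lemma ell_comp_gen:
  assumes "s \<in> Sg" "w \<in> W"
  shows "ell (w \<circ> s) = Suc (ell w) \<or> ell w = Suc (ell (w \<circ> s))"
proof -
  have "ell (w \<circ> s) = ell (s \<circ> inv w)"
    using ell_inv[of "w \<circ> s"] assms by (simp add: inv_comp gen_in inv_gen comp_in)
  then show ?thesis
    using ell_gen_comp[of s "inv w"] assms by (simp add: inv_in ell_inv)
qed

lemma right_descent:
  assumes "w \<in> W" "ell w \<noteq> 0"
  shows "\<exists>s\<in>Sg. ell (w \<circ> s) < ell w"
proof -
  obtain s where s: "s \<in> Sg" "ell (s \<circ> inv w) < ell (inv w)"
    using descent[of "inv w"] assms by (auto simp: inv_in ell_inv)
  have "ell (w \<circ> s) = ell (s \<circ> inv w)"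
    using ell_inv[of "w \<circ> s"] assms s by (simp add: inv_comp gen_in inv_gen comp_in)
  then show ?thesis using s assms by (metis ell_inv)
qed

text \<open>Subadditivity gives one inequality; multiplying back by \<open>inv u\<close>, also of
  length zero, gives the other.\<close>

lemma ell_len0_comp:
  assumes "u \<in> W" "ell u = 0" "w \<in> W"
  shows "ell (u \<circ> w) = ell w" "ell (w \<circ> u) = ell w"
proof -
  have "ell w \<le> ell (u \<circ> w)"
    using ell_comp_le[of "inv u" "u \<circ> w"] assms
    by (simp add: inv_in comp_in ell_inv inv_cancel_comp)
  then show "ell (u \<circ> w) = ell w" using ell_comp_le[of u w] assms by simp
  have "ell w \<le> ell (w \<circ> u)"
    using ell_comp_le[of "w \<circ> u" "inv u"] assms
    by (simp add: inv_in comp_in ell_inv inv_cancel comp_assoc)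
  then show "ell (w \<circ> u) = ell w" using ell_comp_le[of w u] assms by simp
qed

text \<open>Outside the case \<open>s \<circ> w = w \<circ> t\<close>, multiplication on one side
  does not affect whether the generator on the other side is a descent. Folding is applied to
  \<open>w\<close> and to \<open>w \<circ> t\<close>, one for each direction of crossing; the second
  claim is then arithmetic with the lengths of \<open>w\<close>, \<open>s \<circ> w\<close>,
  \<open>w \<circ> t\<close> and \<open>s \<circ> w \<circ> t\<close>.\<close>

lemma folding_sides:
  assumes "s \<in> Sg" "t \<in> Sg" "w \<in> W" "s \<circ> w \<noteq> w \<circ> t"
  shows "ell (s \<circ> (w \<circ> t)) < ell (w \<circ> t) \<longleftrightarrow> ell (s \<circ> w) < ell w"
    and "ell (s \<circ> w \<circ> t) < ell (s \<circ> w) \<longleftrightarrow> ell (w \<circ> t) < ell w"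
proof -
  have ne: "s \<circ> (w \<circ> t) \<noteq> w \<circ> t \<circ> t"
    using assms by (metis gen_cancel gen_cancel_right comp_assoc)
  show 1: "ell (s \<circ> (w \<circ> t)) < ell (w \<circ> t) \<longleftrightarrow> ell (s \<circ> w) < ell w"
    using folding[OF assms(1-3)] folding[of s t "w \<circ> t"] assms ne ell_gen_comp[OF assms(1,3)]
      ell_gen_comp[of s "w \<circ> t"] gen_cancel_right[of t w] comp_in[OF assms(3) gen_in[OF assms(2)]]
    by (metis less_Suc_eq not_less_eq)
  have "w \<circ> t \<in> W" "s \<circ> w \<in> W" using assms by (simp_all add: comp_in gen_in)
  with 1 show "ell (s \<circ> w \<circ> t) < ell (s \<circ> w) \<longleftrightarrow> ell (w \<circ> t) < ell w"
    using ell_gen_comp[OF assms(1,3)] ell_gen_comp[of s "w \<circ> t"] ell_comp_gen[OF assms(2,3)]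
      ell_comp_gen[of t "s \<circ> w"] assms(1,2)
    unfolding comp_assoc by arith
qed

text \<open>The value of \<open>q\<close> at \<open>s \<circ> w = w \<circ> t\<close> factors in two
  ways once lengths add. If \<open>s\<close> lowers the length of \<open>w\<close>, the same
  argument applies to \<open>s \<circ> w\<close>.\<close>

lemma q_gen_eq:
  assumes "s \<in> Sg" "t \<in> Sg" "w \<in> W" "s \<circ> w = w \<circ> t"
  shows "q s = q t"
proof -
  have *: "q s = q t" if "w \<in> W" "s \<circ> w = w \<circ> t" "ell (s \<circ> w) = Suc (ell w)" for w
  proof -
    have "q (s \<circ> w) = q s * q w"
      by (rule q_comp) (use that assms in \<open>simp_all add: gen_in ell_gen\<close>)
    moreover have "q (w \<circ> t) = q w * q t"
      by (rule q_comp) (use that assms in \<open>simp_all add: gen_in ell_gen\<close>)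
    ultimately show ?thesis using that q_nonzero by auto
  qed
  show ?thesis
  proof (cases "ell (s \<circ> w) = Suc (ell w)")
    case True
    then show ?thesis using * assms by blast
  next
    case False
    then have "ell w = Suc (ell (s \<circ> w))" using ell_gen_comp assms by blast
    then show ?thesis
      using *[of "s \<circ> w"] assms gen_cancel[of s w] gen_cancel_right[of t w]
      by (simp add: comp_in gen_in)
  qed
qed

text \<open>This is \<open>hatT\<close> transported to the group:
  \<open>ell (s \<circ> w) < ell w\<close> says that the wall of \<open>s\<close> separates the
  alcove from its image under \<open>w\<close>, so \<open>chi\<close> is \<open>q s\<close> in the
  first branch and \<open>inverse (q s)\<close> in the second.\<close>

definition left_op :: "('a \<Rightarrow> 'a) \<Rightarrow> (('a \<Rightarrow> 'a) \<Rightarrow> 'k) \<Rightarrow> ('a \<Rightarrow> 'a) \<Rightarrow> 'k" where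
  "left_op s F w = (if ell (s \<circ> w) < ell w then q s * F (s \<circ> w)
     else inverse (q s) * F (s \<circ> w) + (q s - inverse (q s)) * F w)"

text \<open>By the quadratic relation the inverse is \<open>left_op s\<close> minus the scalar
  \<open>q s - inverse (q s)\<close>. The diagonal term thereby moves from the ascending to the
  descending branch.\<close>

definition left_op_inv :: "('a \<Rightarrow> 'a) \<Rightarrow> (('a \<Rightarrow> 'a) \<Rightarrow> 'k) \<Rightarrow> ('a \<Rightarrow> 'a) \<Rightarrow> 'k" where
  "left_op_inv s F w = (if ell (s \<circ> w) < ell w then q s * F (s \<circ> w) - (q s - inverse (q s)) * F w
     else inverse (q s) * F (s \<circ> w))"

definition right_op_inv :: "('a \<Rightarrow> 'a) \<Rightarrow> (('a \<Rightarrow> 'a) \<Rightarrow> 'k) \<Rightarrow> ('a \<Rightarrow> 'a) \<Rightarrow> 'k" where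
  "right_op_inv t F w = (if ell (w \<circ> t) < ell w then q t * F (w \<circ> t) - (q t - inverse (q t)) * F w
     else inverse (q t) * F (w \<circ> t))"

lemma left_op_cong: "(\<And>w. w \<in> W \<Longrightarrow> F w = G w) \<Longrightarrow> s \<in> Sg \<Longrightarrow> w \<in> W \<Longrightarrow> left_op s F w = left_op s G w"
  by (simp add: left_op_def comp_in gen_in)

lemma left_op_inv_cong: "(\<And>w. w \<in> W \<Longrightarrow> F w = G w) \<Longrightarrow> s \<in> Sg \<Longrightarrow> w \<in> W \<Longrightarrow> left_op_inv s F w = left_op_inv s G w"
  by (simp add: left_op_inv_def comp_in gen_in)

lemma left_op_left_op_inv:
  assumes "s \<in> Sg" "w \<in> W"
  shows "left_op s (left_op_inv s F) w = F w" "left_op_inv s (left_op s F) w = F w"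
proof -
  have n: "q s \<noteq> 0" using assms q_nonzero gen_in by blast
  show "left_op s (left_op_inv s F) w = F w"
  proof (cases "ell (s \<circ> w) < ell w")
    case True
    with n assms show ?thesis by (simp add: left_op_def left_op_inv_def gen_cancel)
  next
    case False
    then have "ell w < ell (s \<circ> w)" using ell_gen_comp[OF assms] by auto
    with n assms show ?thesis by (simp add: left_op_def left_op_inv_def gen_cancel algebra_simps)
  qed
  show "left_op_inv s (left_op s F) w = F w"
  proof (cases "ell (s \<circ> w) < ell w")
    case True
    with n assms show ?thesis by (simp add: left_op_def left_op_inv_def gen_cancel algebra_simps)
  next
    case False
    then have "ell w < ell (s \<circ> w)" using ell_gen_comp[OF assms] by auto
    with n assms show ?thesis by (simp add: left_op_def left_op_inv_def gen_cancel)
  qed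
qed

lemma left_op_quadratic:
  assumes "s \<in> Sg" "w \<in> W"
  shows "left_op s (\<lambda>v. left_op s F v + inverse (q s) * F v) w = q s * (left_op s F w + inverse (q s) * F w)"
proof -
  have n: "q s \<noteq> 0" using assms q_nonzero gen_in by blast
  show ?thesis
  proof (cases "ell (s \<circ> w) < ell w")
    case True
    with n assms show ?thesis by (simp add: left_op_def gen_cancel algebra_simps)
  next
    case False
    then have "ell w < ell (s \<circ> w)" using ell_gen_comp[OF assms] by auto
    with n assms show ?thesis by (simp add: left_op_def gen_cancel algebra_simps)
  qed
qed

text \<open>If \<open>s \<circ> w = w \<circ> t\<close>, the parameters agree and both operators act
  by the same formula on the values at \<open>w\<close> and \<open>s \<circ> w\<close>. Otherwise
  the left and right descents are independent, and the operators act like two tensor factors on the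
  values at four elements.\<close>

lemma left_op_inv_right_op_inv:
  assumes "s \<in> Sg" "t \<in> Sg" "w \<in> W"
  shows "left_op_inv s (right_op_inv t F) w = right_op_inv t (left_op_inv s F) w"
proof (cases "s \<circ> w = w \<circ> t")
  case True
  have q: "q s = q t" using q_gen_eq assms True by blast
  have e: "s \<circ> (w \<circ> t) = w" "w \<circ> t \<circ> t = w"
    using assms True gen_cancel gen_cancel_right by metis+
  show ?thesis
    by (simp add: left_op_inv_def right_op_inv_def True q e algebra_simps)
next
  case False
  note sides = folding_sides[OF assms False]
  show ?thesis
    by (cases "ell (s \<circ> w) < ell w"; cases "ell (w \<circ> t) < ell w")
      (use sides in \<open>simp_all add: left_op_inv_def right_op_inv_def comp_assoc algebra_simps\<close>)
qed

section \<open>Words of inverse operators\<close>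

lemma fold_left_op_inv_cong:
  "(\<And>w. w \<in> W \<Longrightarrow> F w = G w) \<Longrightarrow> set ss \<subseteq> Sg \<Longrightarrow> w \<in> W \<Longrightarrow> fold left_op_inv ss F w = fold left_op_inv ss G w"
proof (induction ss arbitrary: F G)
  case (Cons s ss)
  have "left_op_inv s F x = left_op_inv s G x" if "x \<in> W" for x
    using left_op_inv_cong[of F G s x] Cons.prems that by auto
  then have "fold left_op_inv ss (left_op_inv s F) w = fold left_op_inv ss (left_op_inv s G) w"
    using Cons.prems by (intro Cons.IH) auto
  then show ?case by simp
qed simp

lemma fold_left_op_inv_right_op_inv:
  assumes "t \<in> Sg"
  shows "set ss \<subseteq> Sg \<Longrightarrow> w \<in> W \<Longrightarrow> fold left_op_inv ss (right_op_inv t F) w = right_op_inv t (fold left_op_inv ss F) w"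
proof (induction ss arbitrary: F)
  case (Cons s ss)
  have "fold left_op_inv ss (left_op_inv s (right_op_inv t F)) w = fold left_op_inv ss (right_op_inv t (left_op_inv s F)) w"
    using Cons.prems assms by (intro fold_left_op_inv_cong) (auto simp: left_op_inv_right_op_inv)
  then show ?case using Cons.prems Cons.IH[of "left_op_inv s F"] by simp
qed simp

lemma comp_list_in: "set ss \<subseteq> Sg \<Longrightarrow> w \<in> W \<Longrightarrow> comp_list ss w \<in> W"
  by (induction ss) (auto simp: comp_in gen_in comp_list_Cons)

lemma ell_comp_list_le: "set ss \<subseteq> Sg \<Longrightarrow> w \<in> W \<Longrightarrow> ell (comp_list ss w) \<le> length ss + ell w"
proof (induction ss)
  case (Cons s ss)
  then show ?case
    using ell_gen_comp[of s "comp_list ss w"] comp_list_in[of ss w]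
    by (auto simp: comp_list_Cons comp_def)
qed simp

lemma comp_list_shift: "comp_list ss (w \<circ> v) = comp_list ss w \<circ> v"
  by (induction ss) (auto simp: comp_assoc comp_list_Cons)

text \<open>Along a reduced expression every factor increases the length, so only the length-increasing
  branch of each inverse operator is ever used.\<close>

lemma fold_left_op_inv_reduced:
  assumes "z \<in> W"
  shows "set ss \<subseteq> Sg \<Longrightarrow> ell (comp_list ss z) = length ss + ell z \<Longrightarrow>
    fold left_op_inv ss F z = q z / q (comp_list ss z) * F (comp_list ss z)"
proof (induction ss arbitrary: F)
  case Nil
  then show ?case using assms q_nonzero by simp
next
  case (Cons s ss)
  let ?z = "comp_list ss z"
  have z: "?z \<in> W" using comp_list_in Cons assms by simp
  have s: "s \<in> Sg" using Cons by simp
  have le: "ell ?z = length ss + ell z" "ell (s \<circ> ?z) = Suc (ell ?z)"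
    using Cons.prems ell_comp_list_le[of ss z] ell_gen_comp[OF s z] assms
    by (auto simp: comp_list_Cons comp_def)
  have "left_op_inv s F ?z = inverse (q s) * F (s \<circ> ?z)" using le by (simp add: left_op_inv_def)
  moreover have "q (s \<circ> ?z) = q s * q ?z" using q_comp[of s ?z] s z le by (simp add: gen_in ell_gen)
  ultimately show ?case using Cons le by (simp add: divide_inverse comp_list_Cons comp_def)
qed

text \<open>The second component is the factor of length zero at the right end;
  \<open>ell w = length ss\<close> says that no letter of \<open>ss\<close> is wasted.\<close>

definition reduced :: "('a \<Rightarrow> 'a) \<Rightarrow> ('a \<Rightarrow> 'a) list \<times> ('a \<Rightarrow> 'a) \<Rightarrow> bool" where
  "reduced w = (\<lambda>(ss, u). set ss \<subseteq> Sg \<and> u \<in> W \<and> ell u = 0 \<and> w = comp_list ss u \<and> ell w = length ss)"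

definition word_op :: "('a \<Rightarrow> 'a) list \<times> ('a \<Rightarrow> 'a) \<Rightarrow> (('a \<Rightarrow> 'a) \<Rightarrow> 'k) \<Rightarrow> ('a \<Rightarrow> 'a) \<Rightarrow> 'k" where
  "word_op = (\<lambda>(ss, u) F. foldr left_op ss (\<lambda>v. F (inv u \<circ> v)))"

text \<open>\<open>fold\<close> applies the head of the list first whereas \<open>foldr\<close> in
  \<open>word_op\<close> applies it last, so the factors are inverted in reverse order. The argument
  \<open>u \<circ> v\<close> undoes the translation by \<open>inv u\<close>.\<close>

definition word_op_inv :: "('a \<Rightarrow> 'a) list \<times> ('a \<Rightarrow> 'a) \<Rightarrow> (('a \<Rightarrow> 'a) \<Rightarrow> 'k) \<Rightarrow> ('a \<Rightarrow> 'a) \<Rightarrow> 'k" where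
  "word_op_inv = (\<lambda>(ss, u) F v. fold left_op_inv ss F (u \<circ> v))"

lemma reduced_in: "reduced w p \<Longrightarrow> w \<in> W"
  by (auto simp: reduced_def comp_list_in)

lemma reduced_exists: "w \<in> W \<Longrightarrow> \<exists>p. reduced w p"
proof (induction "ell w" arbitrary: w rule: less_induct)
  case less
  show ?case
  proof (cases "ell w = 0")
    case True
    then have "reduced w ([], w)" using less by (simp add: reduced_def)
    then show ?thesis by blast
  next
    case False
    then obtain s where s: "s \<in> Sg" "ell (s \<circ> w) < ell w" using descent less by blast
    then obtain ss u where "reduced (s \<circ> w) (ss, u)"
      using less by (metis comp_in gen_in surj_pair)
    then have "reduced w (s # ss, u)"
      using s ell_gen_comp[OF s(1) less.prems] gen_cancel[OF s(1), of w]
      by (auto simp: reduced_def comp_list_Cons)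
    then show ?thesis by blast
  qed
qed

lemma foldr_left_op_cong:
  "(\<And>w. w \<in> W \<Longrightarrow> F w = G w) \<Longrightarrow> set ss \<subseteq> Sg \<Longrightarrow> w \<in> W \<Longrightarrow> foldr left_op ss F w = foldr left_op ss G w"
proof (induction ss arbitrary: w)
  case (Cons s ss)
  have "left_op s (foldr left_op ss F) w = left_op s (foldr left_op ss G) w"
    using Cons.prems by (intro left_op_cong Cons.IH) auto
  then show ?case by simp
qed simp

lemma word_op_cong:
  "reduced w p \<Longrightarrow> (\<And>w. w \<in> W \<Longrightarrow> F w = G w) \<Longrightarrow> v \<in> W \<Longrightarrow> word_op p F v = word_op p G v"
  by (auto simp: word_op_def reduced_def comp_in inv_in intro!: foldr_left_op_cong split: prod.splits)

lemma foldr_left_op_fold_left_op_inv: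
  "set ss \<subseteq> Sg \<Longrightarrow> w \<in> W \<Longrightarrow> foldr left_op ss (fold left_op_inv ss F) w = F w"
proof (induction ss arbitrary: F w)
  case (Cons s ss)
  have "left_op s (foldr left_op ss (fold left_op_inv ss (left_op_inv s F))) w = left_op s (left_op_inv s F) w"
    using Cons.prems by (intro left_op_cong Cons.IH) auto
  then show ?case using Cons.prems by (simp add: left_op_left_op_inv)
qed simp

lemma fold_left_op_inv_foldr_left_op:
  "set ss \<subseteq> Sg \<Longrightarrow> w \<in> W \<Longrightarrow> fold left_op_inv ss (foldr left_op ss F) w = F w"
proof (induction ss arbitrary: w)
  case (Cons s ss)
  have "fold left_op_inv ss (left_op_inv s (left_op s (foldr left_op ss F))) w = fold left_op_inv ss (foldr left_op ss F) w"
    using Cons.prems by (intro fold_left_op_inv_cong) (auto simp: left_op_left_op_inv)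
  then show ?case using Cons.prems Cons.IH[of w] by simp
qed simp

lemma word_op_word_op_inv:
  assumes "reduced w p" "v \<in> W" shows "word_op p (word_op_inv p F) v = F v"
proof -
  obtain ss u where p: "p = (ss, u)" by fastforce
  have u: "u \<in> W" "set ss \<subseteq> Sg" using assms p by (auto simp: reduced_def)
  show ?thesis
    using foldr_left_op_fold_left_op_inv u assms by (simp add: p word_op_def word_op_inv_def inv_cancel_comp)
qed

lemma word_op_inv_word_op:
  assumes "reduced w p" "v \<in> W" shows "word_op_inv p (word_op p F) v = F v"
proof -
  obtain ss u where p: "p = (ss, u)" by fastforce
  have u: "u \<in> W" "set ss \<subseteq> Sg" using assms p by (auto simp: reduced_def)
  show ?thesis
    using fold_left_op_inv_foldr_left_op u assms by (simp add: p word_op_def word_op_inv_def inv_cancel_comp comp_in)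
qed

lemma word_op_inv_right_op_inv:
  assumes "reduced w p" "t \<in> Sg" "v \<in> W"
  shows "word_op_inv p (right_op_inv t F) v = right_op_inv t (word_op_inv p F) v"
proof -
  obtain ss u where p: "p = (ss, u)" by fastforce
  have u: "u \<in> W" "set ss \<subseteq> Sg" "ell u = 0" using assms p by (auto simp: reduced_def)
  have "ell (u \<circ> v) = ell v" "ell (u \<circ> v \<circ> t) = ell (v \<circ> t)"
    using u assms ell_len0_comp(1)[of u] by (auto simp: comp_assoc comp_in gen_in)
  then show ?thesis
    using fold_left_op_inv_right_op_inv[of t ss "u \<circ> v"] u assms
      by (auto simp: p word_op_inv_def comp_in right_op_inv_def comp_assoc)
qed

text \<open>Evaluated at an element of length zero, both operators read off the value at \<open>w\<close>; the
  commuting right operators propagate the equality to all of \<open>W\<close>.\<close>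

lemma word_op_inv_unique:
  assumes "reduced w p" "reduced w p'"
  shows "v \<in> W \<Longrightarrow> word_op_inv p F v = word_op_inv p' F v"
proof (induction "ell v" arbitrary: v F rule: less_induct)
  case less
  show ?case
  proof (cases "ell v = 0")
    case True
    have "word_op_inv p F v = 1 / q (w \<circ> v) * F (w \<circ> v)" if "reduced w p" for p
    proof -
      obtain ss u where p: "p = (ss, u)" by fastforce
      have u: "u \<in> W" "set ss \<subseteq> Sg" "ell u = 0" "w = comp_list ss u" "ell w = length ss"
        using that p by (auto simp: reduced_def)
      have w: "w \<in> W" using that reduced_in by blast
      have e: "comp_list ss (u \<circ> v) = w \<circ> v" using u by (simp add: comp_list_shift)
      have l: "ell (u \<circ> v) = 0" using ell_len0_comp u True less by simp
      then show ?thesis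
        using fold_left_op_inv_reduced[of "u \<circ> v" ss F] u w less True
        by (simp add: p word_op_inv_def e comp_in q_len0 ell_len0_comp)
    qed
    then show ?thesis using assms by simp
  next
    case False
    then obtain t where t: "t \<in> Sg" "ell (v \<circ> t) < ell v" using right_descent less by blast
    have vt: "v \<circ> t \<in> W" using t less by (simp add: comp_in gen_in)
    \<comment> \<open>At \<open>v \<circ> t\<close> the generator \<open>t\<close> raises the
      length, so \<open>right_op_inv t\<close> has a single term there and can be solved for the
      value at \<open>v\<close>. This replaces \<open>F\<close> by \<open>right_op_inv t F\<close>,
      which is why \<open>F\<close> is generalised in the induction.\<close>
    have "word_op_inv p F v = q t * word_op_inv p (right_op_inv t F) (v \<circ> t)" if "reduced w p" for p
    proof -
      have "right_op_inv t (word_op_inv p F) (v \<circ> t) = inverse (q t) * word_op_inv p F v"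
        using t by (simp add: right_op_inv_def gen_cancel_right)
      then show ?thesis using word_op_inv_right_op_inv[OF that t(1) vt, of F] q_nonzero t by (simp add: gen_in)
    qed
    then show ?thesis using less.hyps[OF t(2) vt] assms by simp
  qed
qed

text \<open>Operators with the same two-sided inverse coincide. The chain inserts one inverse and
  exchanges it for the other, using congruence because all identities hold on \<open>W\<close>
  only.\<close>

lemma word_op_unique:
  assumes "reduced w p" "reduced w p'" "v \<in> W"
  shows "word_op p F v = word_op p' F v"
proof -
  have "word_op p F v = word_op p (word_op_inv p' (word_op p' F)) v"
    by (rule word_op_cong[OF assms(1)]) (simp_all add: word_op_inv_word_op[OF assms(2)] assms(3))
  also have "\<dots> = word_op p (word_op_inv p (word_op p' F)) v"
    by (rule word_op_cong[OF assms(1)]) (simp_all add: word_op_inv_unique[OF assms(1,2)] assms(3))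
  also have "\<dots> = word_op p' F v" using word_op_word_op_inv assms by blast
  finally show ?thesis .
qed

section \<open>Operators attached to group elements\<close>

definition Phi :: "('a \<Rightarrow> 'a) \<Rightarrow> (('a \<Rightarrow> 'a) \<Rightarrow> 'k) \<Rightarrow> ('a \<Rightarrow> 'a) \<Rightarrow> 'k" where
  "Phi w = word_op (SOME p. reduced w p)"

lemma reduced_some: "w \<in> W \<Longrightarrow> reduced w (SOME p. reduced w p)"
  by (rule someI_ex[OF reduced_exists])

lemma Phi_eq_word_op: "reduced w p \<Longrightarrow> v \<in> W \<Longrightarrow> Phi w F v = word_op p F v"
  by (simp add: Phi_def word_op_unique[OF reduced_some[OF reduced_in]])

lemma Phi_cong: "w \<in> W \<Longrightarrow> (\<And>w. w \<in> W \<Longrightarrow> F w = G w) \<Longrightarrow> v \<in> W \<Longrightarrow> Phi w F v = Phi w G v"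
  unfolding Phi_def by (rule word_op_cong[OF reduced_some])

lemma Phi_len0: "u \<in> W \<Longrightarrow> ell u = 0 \<Longrightarrow> v \<in> W \<Longrightarrow> Phi u F v = F (inv u \<circ> v)"
  using Phi_eq_word_op[of u "([], u)"] by (simp add: reduced_def word_op_def)

lemma Phi_gen_comp:
  assumes "s \<in> Sg" "w \<in> W" "ell (s \<circ> w) = Suc (ell w)" "v \<in> W"
  shows "Phi (s \<circ> w) F v = left_op s (Phi w F) v"
proof -
  obtain ss u where p: "reduced w (ss, u)" using reduced_exists assms by (metis surj_pair)
  then have "reduced (s \<circ> w) (s # ss, u)" using assms by (auto simp: reduced_def comp_list_Cons)
  then have "Phi (s \<circ> w) F v = left_op s (word_op (ss, u) F) v"
    using Phi_eq_word_op assms by (simp add: word_op_def)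
  also have "\<dots> = left_op s (Phi w F) v" using Phi_eq_word_op[OF p] assms by (intro left_op_cong) auto
  finally show ?thesis .
qed

lemma Phi_gen:
  assumes "s \<in> Sg" "v \<in> W"
  shows "Phi s F v = left_op s F v"
proof -
  have "Phi (s \<circ> id) F v = left_op s (Phi id F) v"
    using assms Phi_gen_comp[of s id v F] by (simp add: id_in ell_id ell_gen)
  also have "\<dots> = left_op s F v"
    using assms by (intro left_op_cong) (auto simp: Phi_len0 id_in ell_id)
  finally show ?thesis by simp
qed

text \<open>Conjugation by an element of length zero permutes the generators:
  \<open>u \<circ> s\<close> has length one, hence a left descent \<open>s'\<close>, which is not a
  descent of \<open>u\<close>; folding then identifies the two products.\<close>

lemma conj_gen:
  assumes "u \<in> W" "ell u = 0" "s \<in> Sg"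
  shows "\<exists>s'\<in>Sg. s' \<circ> u = u \<circ> s"
proof -
  have us: "u \<circ> s \<in> W" "ell (u \<circ> s) = 1"
    using assms by (auto simp: comp_in gen_in ell_len0_comp ell_gen)
  then obtain s' where s': "s' \<in> Sg" "ell (s' \<circ> (u \<circ> s)) < ell (u \<circ> s)"
    using descent[of "u \<circ> s"] by auto
  have "ell (s' \<circ> u) = 1" using s' assms by (simp add: ell_len0_comp gen_in ell_gen)
  then show ?thesis using folding[of s' s u] s' assms by auto
qed

text \<open>Translation by \<open>u\<close> intertwines \<open>left_op s\<close> with
  \<open>left_op s'\<close> for the conjugate generator, since lengths and parameters are preserved.
  This is the base case of \<open>Phi_comp\<close>.\<close>

lemma Phi_len0_comp:
  assumes "u \<in> W" "ell u = 0"
  shows "w \<in> W \<Longrightarrow> v \<in> W \<Longrightarrow> Phi (u \<circ> w) F v = Phi w F (inv u \<circ> v)"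
proof (induction "ell w" arbitrary: w v rule: less_induct)
  case less
  show ?case
  proof (cases "ell w = 0")
    case True
    then show ?thesis
      using less assms by (simp add: Phi_len0 comp_in inv_in ell_len0_comp inv_comp comp_assoc)
  next
    case False
    then obtain s where s: "s \<in> Sg" "ell (s \<circ> w) < ell w" using descent less by blast
    define w' where "w' = s \<circ> w"
    have w': "w' \<in> W" "w = s \<circ> w'" "ell w = Suc (ell w')" "ell w' < ell w"
      using s less ell_gen_comp[of s w] by (auto simp: w'_def comp_in gen_in gen_cancel)
    obtain s' where s': "s' \<in> Sg" "s' \<circ> u = u \<circ> s" using conj_gen assms s by blast
    have q: "q s' = q s" using q_gen_eq s' s assms by blast
    have uw: "u \<circ> w = s' \<circ> (u \<circ> w')"
      unfolding w'(2) using s'(2) by (metis comp_assoc)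
    have e: "s \<circ> (inv u \<circ> v) = inv u \<circ> (s' \<circ> v)"
    proof -
      have "u \<circ> (s \<circ> (inv u \<circ> v)) = s' \<circ> (u \<circ> (inv u \<circ> v))"
        using s'(2) by (metis comp_assoc)
      then show ?thesis using assms by (metis inv_cancel_comp)
    qed
    have l: "ell (inv u \<circ> v) = ell v" "ell (inv u \<circ> (s' \<circ> v)) = ell (s' \<circ> v)"
      using ell_len0_comp(1)[of "inv u"] assms s' less by (auto simp: ell_inv inv_in comp_in gen_in)
    have "Phi (u \<circ> w) F v = left_op s' (Phi (u \<circ> w') F) v"
      unfolding uw using s' w' assms less uw[symmetric]
      by (intro Phi_gen_comp) (auto simp: comp_in ell_len0_comp)
    also have "\<dots> = left_op s' (\<lambda>v. Phi w' F (inv u \<circ> v)) v"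
      using less w' s' by (intro left_op_cong) auto
    also have "\<dots> = left_op s (Phi w' F) (inv u \<circ> v)"
      by (simp add: left_op_def q e l)
    also have "\<dots> = Phi w F (inv u \<circ> v)"
      unfolding w'(2) using s w' assms less by (intro Phi_gen_comp[symmetric]) (auto simp: comp_in inv_in)
    finally show ?thesis .
  qed
qed

theorem Phi_comp:
  assumes "w' \<in> W"
  shows "w \<in> W \<Longrightarrow> ell (w \<circ> w') = ell w + ell w' \<Longrightarrow> v \<in> W \<Longrightarrow> Phi (w \<circ> w') F v = Phi w (Phi w' F) v"
proof (induction "ell w" arbitrary: w v rule: less_induct)
  case less
  show ?case
  proof (cases "ell w = 0")
    case True
    then show ?thesis using less assms by (simp add: Phi_len0 Phi_len0_comp)
  next
    case False
    then obtain s where s: "s \<in> Sg" "ell (s \<circ> w) < ell w" using descent less by blast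
    define x where "x = s \<circ> w"
    have x: "x \<in> W" "w = s \<circ> x" "ell w = Suc (ell x)" "ell x < ell w"
      using s less ell_gen_comp[of s w] by (auto simp: x_def comp_in gen_in gen_cancel)
    have ww: "w \<circ> w' = s \<circ> (x \<circ> w')" unfolding x(2) by (simp add: comp_assoc)
    have xw: "x \<circ> w' \<in> W" using x assms comp_in by blast
    \<comment> \<open>Additivity descends to the shorter factor: subadditivity bounds the length of
      \<open>x \<circ> w'\<close> above, and \<open>s\<close> changes it by only one, which bounds
      it below.\<close>
    have l: "ell (x \<circ> w') = ell x + ell w'" "ell (s \<circ> (x \<circ> w')) = Suc (ell (x \<circ> w'))"
      using ell_gen_comp[OF s(1) xw] ell_comp_le[OF x(1) assms] less.prems x ww by auto
    have "Phi (w \<circ> w') F v = left_op s (Phi (x \<circ> w') F) v"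
      unfolding ww using s xw l less by (intro Phi_gen_comp) auto
    also have "\<dots> = left_op s (Phi x (Phi w' F)) v"
      using less x s l by (intro left_op_cong) auto
    also have "\<dots> = Phi w (Phi w' F) v"
      unfolding x(2) using s x less by (intro Phi_gen_comp[symmetric]) auto
    finally show ?thesis .
  qed
qed

end

section \<open>Geometry of the alcove\<close>

lemma inner_coroot_self: "a \<noteq> 0 \<Longrightarrow> a \<bullet> coroot a = 2"
  by (simp add: coroot_def)

lemma coroot_minus: "coroot (- a) = - coroot a"
  by (simp add: coroot_def)

lemma coroot_coroot: "coroot (coroot a) = a"
  by (cases "a = 0") (simp_all add: coroot_def field_simps)

lemma coroot_inject: "coroot a = coroot b \<longleftrightarrow> a = b"
  by (metis coroot_coroot)

lemma inner_coroot_pos_iff: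
  assumes "a \<noteq> 0"
  shows "0 < x \<bullet> coroot a \<longleftrightarrow> 0 < x \<bullet> a" "0 \<le> x \<bullet> coroot a \<longleftrightarrow> 0 \<le> x \<bullet> a"
proof -
  define c where "c = 2 / (a \<bullet> a)"
  have "0 < c" "x \<bullet> coroot a = c * (x \<bullet> a)" using assms by (simp_all add: c_def coroot_def)
  then show "0 < x \<bullet> coroot a \<longleftrightarrow> 0 < x \<bullet> a" "0 \<le> x \<bullet> coroot a \<longleftrightarrow> 0 \<le> x \<bullet> a"
    by (simp_all add: zero_less_mult_iff zero_le_mult_iff)
qed

lemma coroot_orthogonal:
  assumes "orthogonal_transformation g"
  shows "coroot (g a) = g (coroot a)"
  using assms by (simp add: coroot_def orthogonal_transformation_def linear_scale)

lemma inner_refl_aff: "refl_aff b m x \<bullet> c = x \<bullet> c - (x \<bullet> coroot b - of_int m) * (b \<bullet> c)"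
  by (simp add: refl_aff_def inner_diff_left)

lemma refl_aff_involution: "a \<noteq> 0 \<Longrightarrow> refl_aff a k (refl_aff a k x) = x"
  unfolding refl_aff_def[of a k "refl_aff a k x"]
  by (simp add: inner_refl_aff inner_coroot_self) (simp add: refl_aff_def algebra_simps)

lemma orthogonal_refl_aff:
  assumes "a \<noteq> 0"
  shows "orthogonal_transformation (refl_aff a 0)"
proof -
  have "linear (refl_aff a 0)"
    by (rule linearI) (simp_all add: refl_aff_def inner_add_left algebra_simps)
  moreover have "refl_aff a 0 v \<bullet> refl_aff a 0 w = v \<bullet> w" for v w
    using assms
    by (simp add: refl_aff_def coroot_def inner_diff_left inner_diff_right inner_commute field_simps)
  ultimately show ?thesis by (simp add: orthogonal_transformation_def)
qed

lemma hyperpl_minus: "hyperpl (- a) (- k) = hyperpl a k"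
  by (auto simp: hyperpl_def coroot_minus)

lemma refl_aff_minus: "refl_aff (- a) (- k) = refl_aff a k"
  by (rule ext) (simp add: refl_aff_def coroot_minus algebra_simps)

lemma refl_aff_fixed_iff: "a \<noteq> 0 \<Longrightarrow> refl_aff a k x = x \<longleftrightarrow> x \<in> hyperpl a k"
  by (auto simp: refl_aff_def hyperpl_def)

text \<open>\<open>sep a k x y\<close> is strict separation: a point on the hyperplane is separated from nothing.\<close>

definition sep :: "'a::euclidean_space \<Rightarrow> int \<Rightarrow> 'a \<Rightarrow> 'a \<Rightarrow> bool" where
  "sep a k x y \<longleftrightarrow> (x \<bullet> coroot a - of_int k) * (y \<bullet> coroot a - of_int k) < 0"

lemma sep_minus: "sep (- a) (- k) x y = sep a k x y"
proof -
  have "(- (x \<bullet> coroot a) + of_int k) * (- (y \<bullet> coroot a) + of_int k)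
     = (x \<bullet> coroot a - of_int k) * (y \<bullet> coroot a - of_int k)" by (simp add: algebra_simps)
  then show ?thesis by (simp add: sep_def coroot_minus)
qed

lemma sep_commute: "sep a k x y = sep a k y x"
  by (simp add: sep_def mult.commute)

text \<open>\<open>len\<close> counts hyperplanes as sets, while \<open>sep\<close> refers to a root
  and an integer. The two affine forms of one hyperplane are proportional, and only the square of
  the factor enters the product in \<open>sep\<close>.\<close>

lemma hyperpl_eq_sep:
  assumes "a \<noteq> 0" "b \<noteq> 0" "hyperpl a k = hyperpl b m"
  shows "sep a k x y = sep b m x y"
proof -
  \<comment> \<open>Moving by \<open>a\<close> changes the first form by 2 and the second by
    \<open>a \<bullet> coroot b\<close>; their quotient is the factor. Below, \<open>z'\<close> is
    the orthogonal projection of \<open>z\<close> to the hyperplane.\<close>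
  define c where "c = (a \<bullet> coroot b) / 2"
  have *: "z \<bullet> coroot b - of_int m = c * (z \<bullet> coroot a - of_int k)" for z
  proof -
    define z' where "z' = z - ((z \<bullet> coroot a - of_int k) / 2) *\<^sub>R a"
    have "z' \<in> hyperpl a k"
      using assms(1) by (simp add: z'_def hyperpl_def inner_diff_left inner_coroot_self field_simps)
    then have "z' \<bullet> coroot b = of_int m" unfolding assms(3) by (simp add: hyperpl_def)
    then show ?thesis by (simp add: z'_def inner_diff_left c_def field_simps)
  qed
  have "c \<noteq> 0"
  \<comment> \<open>A zero factor would make the second form vanish identically, but it takes
    different values at \<open>b\<close> and at 0.\<close>
  proof
    assume "c = 0"
    then have "b \<bullet> coroot b = of_int m" "(0::'a) \<bullet> coroot b = of_int m"
      using * by (metis mult_zero_left eq_iff_diff_eq_0)+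
    then show False using assms inner_coroot_self by force
  qed
  then have "0 < c * c" by (auto simp: zero_less_mult_iff linorder_neq_iff)
  moreover have "(x \<bullet> coroot b - of_int m) * (y \<bullet> coroot b - of_int m)
    = (c * c) * ((x \<bullet> coroot a - of_int k) * (y \<bullet> coroot a - of_int k))"
    by (simp add: * algebra_simps)
  ultimately show ?thesis unfolding sep_def by (simp add: mult_less_0_iff)
qed

lemma no_int_between:
  fixes u v :: real and n k :: int
  assumes "of_int n < u" "u < of_int n + 1" "of_int n < v" "v < of_int n + 1"
  shows "0 < (u - of_int k) * (v - of_int k)"
proof (cases "k \<le> n")
  case True
  then have "(of_int k :: real) \<le> of_int n" by simp
  then show ?thesis using assms by simp
next
  case False
  then have "(of_int n + 1 :: real) \<le> of_int k"
    by (metis add1_zle_eq not_le of_int_1 of_int_add of_int_le_iff)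
  then show ?thesis using assms by (intro mult_neg_neg) auto
qed

lemma unique_int_between:
  fixes u v :: real and n k :: int
  assumes "of_int n < u" "u < of_int n + 1" "of_int n - 1 < v" "v < of_int n"
    "(u - of_int k) * (v - of_int k) < 0"
  shows "k = n"
proof (rule ccontr)
  assume "k \<noteq> n"
  then consider "k + 1 \<le> n" | "n + 1 \<le> k" by linarith
  then show False
  proof cases
    case 1
    then have "(of_int k + 1 :: real) \<le> of_int n"
      by (metis of_int_1 of_int_add of_int_le_iff)
    then have "0 < (u - of_int k) * (v - of_int k)" using assms by (intro mult_pos_pos) auto
    then show False using assms by simp
  next
    case 2
    then have "(of_int n + 1 :: real) \<le> of_int k"
      by (metis of_int_1 of_int_add of_int_le_iff)
    then have "0 < (u - of_int k) * (v - of_int k)" using assms by (intro mult_neg_neg) auto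
    then show False using assms by simp
  qed
qed

lemma finite_int_between: "finite {k::int. ((u::real) - of_int k) * (v - of_int k) < 0}"
proof (rule finite_subset)
  show "{k::int. (u - of_int k) * (v - of_int k) < 0} \<subseteq> {\<lfloor>min u v\<rfloor>..\<lceil>max u v\<rceil>}"
  proof
    fix k :: int assume "k \<in> {k::int. (u - of_int k) * (v - of_int k) < 0}"
    then have "min u v \<le> of_int k" "of_int k \<le> max u v"
      by (auto simp: mult_less_0_iff)
    then show "k \<in> {\<lfloor>min u v\<rfloor>..\<lceil>max u v\<rceil>}"
      by simp linarith
  qed
qed simp

subsection \<open>The extended affine Weyl group\<close>

lemma refl_aff_in_ext_weyl: "a \<in> R \<Longrightarrow> refl_aff a 0 \<in> ext_weyl R"
  using ew_refl[OF ew_id, of a R] by simp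

lemma transl_in_ext_weyl: "l \<in> weight_lattice R \<Longrightarrow> transl l \<in> ext_weyl R"
  using ew_transl[OF ew_id, of l R] by simp

lemma ext_weyl_comp: "v \<in> ext_weyl R \<Longrightarrow> w \<in> ext_weyl R \<Longrightarrow> v \<circ> w \<in> ext_weyl R"
proof (induction rule: ext_weyl.induct)
  case (ew_refl v a)
  then show ?case using ext_weyl.ew_refl[of "v \<circ> w" R a] by (simp add: comp_def)
next
  case (ew_transl v l)
  then show ?case using ext_weyl.ew_transl[of "v \<circ> w" R l] by (simp add: comp_def)
qed simp

locale root_datum =
  fixes R S :: "'a::euclidean_space set" and a0 :: 'a
  assumes root_system: "root_system R" and base: "is_base R S" and highest: "highest_coroot_root R S a0"
begin

abbreviation "W \<equiv> ext_weyl R"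
abbreviation "Rp \<equiv> pos_roots R S"

lemma finite_R: "finite R" and root_nonzero: "a \<in> R \<Longrightarrow> a \<noteq> 0"
  and refl_root: "a \<in> R \<Longrightarrow> b \<in> R \<Longrightarrow> refl_aff a 0 b \<in> R"
  and integral: "a \<in> R \<Longrightarrow> b \<in> R \<Longrightarrow> b \<bullet> coroot a \<in> \<int>"
  and proportional: "a \<in> R \<Longrightarrow> c *\<^sub>R a \<in> R \<Longrightarrow> c = 1 \<or> c = - 1"
  using root_system by (auto simp: root_system_def)

lemma uminus_root: "a \<in> R \<Longrightarrow> - a \<in> R"
  using refl_root[of a a] root_nonzero[of a]
    by (simp add: refl_aff_def inner_coroot_self algebra_simps scaleR_2)

lemma root_in_weight_lattice: "a \<in> R \<Longrightarrow> a \<in> weight_lattice R"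
  using integral by (simp add: weight_lattice_def)

lemma refl_image_R:
  assumes "a \<in> R"
  shows "refl_aff a 0 ` R = R"
proof
  show "R \<subseteq> refl_aff a 0 ` R"
  proof
    fix b assume "b \<in> R"
    then show "b \<in> refl_aff a 0 ` R"
      using refl_root[OF assms] refl_aff_involution[OF root_nonzero[OF assms], of 0 b]
      by (intro image_eqI[of b _ "refl_aff a 0 b"]) auto
  qed
qed (use refl_root[OF assms] in blast)

lemma orthogonal_weight_lattice:
  assumes "orthogonal_transformation g" "g ` R = R" "l \<in> weight_lattice R"
  shows "g l \<in> weight_lattice R"
  unfolding weight_lattice_def
proof (intro CollectI ballI)
  fix a assume "a \<in> R"
  then obtain b where b: "b \<in> R" "a = g b" using assms(2) by blast
  have "g l \<bullet> coroot a = l \<bullet> coroot b"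
    using assms(1) b by (simp add: coroot_orthogonal) (simp add: orthogonal_transformation_def)
  then show "g l \<bullet> coroot a \<in> \<int>" using b assms(3) by (simp add: weight_lattice_def)
qed

lemma weight_lattice_add:
  "l \<in> weight_lattice R \<Longrightarrow> l' \<in> weight_lattice R \<Longrightarrow> l + l' \<in> weight_lattice R"
  by (simp add: weight_lattice_def inner_add_left)

text \<open>The linear part is recorded as an orthogonal symmetry of \<open>R\<close>, which is what
  is needed to transport roots, coroots and weights.\<close>

lemma ext_weyl_form:
  "w \<in> W \<Longrightarrow> \<exists>g l. orthogonal_transformation g \<and> g ` R = R \<and> l \<in> weight_lattice R \<and> w = (\<lambda>x. g x + l)"
proof (induction rule: ext_weyl.induct)
  case ew_id
  have "orthogonal_transformation (id :: 'a \<Rightarrow> 'a)" "(id :: 'a \<Rightarrow> 'a) = (\<lambda>x. id x + 0)"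
    "0 \<in> weight_lattice R"
    by (auto simp: weight_lattice_def orthogonal_transformation_def linear_id id_def)
  then show ?case by (intro exI[of _ id] exI[of _ 0]) (simp add: fun_eq_iff)
next
  case (ew_refl w a)
  then obtain g l where gl: "orthogonal_transformation g" "g ` R = R" "l \<in> weight_lattice R"
    "w = (\<lambda>x. g x + l)" by blast
  let ?r = "refl_aff a 0"
  have r: "orthogonal_transformation ?r" using ew_refl root_nonzero orthogonal_refl_aff by blast
  have "orthogonal_transformation (?r \<circ> g)" using r gl by (simp add: orthogonal_transformation_compose)
  moreover have "(?r \<circ> g) ` R = R"
    unfolding image_comp[symmetric] gl(2) by (rule refl_image_R[OF ew_refl(2)])
  moreover have "?r l \<in> weight_lattice R"
    using orthogonal_weight_lattice[OF r refl_image_R[OF ew_refl(2)]] gl by simp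
  moreover have "?r \<circ> w = (\<lambda>x. (?r \<circ> g) x + ?r l)"
    using r by (auto simp: gl fun_eq_iff orthogonal_transformation_def linear_add)
  ultimately show ?case by blast
next
  case (ew_transl w m)
  then obtain g l where gl: "orthogonal_transformation g" "g ` R = R" "l \<in> weight_lattice R"
    "w = (\<lambda>x. g x + l)" by blast
  have "transl m \<circ> w = (\<lambda>x. g x + (l + m))" by (auto simp: gl transl_def)
  then show ?case using gl weight_lattice_add[of l m] ew_transl by blast
qed

lemma bij_ext_weyl: "w \<in> W \<Longrightarrow> bij w"
proof -
  assume "w \<in> W"
  then obtain g l where gl: "orthogonal_transformation g" "w = (\<lambda>x. g x + l)"
    using ext_weyl_form by blast
  have "w = (\<lambda>x. x + l) \<circ> g" using gl by auto
  then show "bij w" using orthogonal_transformation_bij[OF gl(1)] bij_comp[of g "\<lambda>x. x + l"]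
    by (simp add: bij_plus_right)
qed

lemma ext_weyl_inv: "w \<in> W \<Longrightarrow> inv w \<in> W"
proof (induction rule: ext_weyl.induct)
  case ew_id
  show ?case unfolding inv_id by (rule ext_weyl.ew_id)
next
  case (ew_refl w a)
  have "inv (refl_aff a 0) = refl_aff a 0"
    using refl_aff_involution[of a 0] root_nonzero ew_refl by (intro inv_unique_comp) auto
  then have "inv (refl_aff a 0 \<circ> w) = inv w \<circ> refl_aff a 0"
    using o_inv_distrib[OF bij_ext_weyl bij_ext_weyl] ew_refl refl_aff_in_ext_weyl by metis
  then show ?case using ext_weyl_comp ew_refl refl_aff_in_ext_weyl by metis
next
  case (ew_transl w l)
  have "inv (transl l) = transl (- l)"
    by (intro inv_unique_comp) (auto simp: transl_def)
  then have "inv (transl l \<circ> w) = inv w \<circ> transl (- l)"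
    using o_inv_distrib[OF bij_ext_weyl bij_ext_weyl] ew_transl transl_in_ext_weyl by metis
  moreover have "- l \<in> weight_lattice R" using ew_transl by (simp add: weight_lattice_def)
  ultimately show ?case using ext_weyl_comp ew_transl transl_in_ext_weyl by metis
qed

text \<open>The root \<open>a\<close> is the image of \<open>b\<close> under the linear part of \<open>w\<close>.\<close>

definition carries :: "('a \<Rightarrow> 'a) \<Rightarrow> 'a \<Rightarrow> 'a \<Rightarrow> int \<Rightarrow> bool" where
  "carries w b a m \<longleftrightarrow> (\<forall>x. w x \<bullet> coroot a = x \<bullet> coroot b + of_int m) \<and>
     (\<forall>x c. w (x + c *\<^sub>R b) = w x + c *\<^sub>R a)"

lemma carries_form:
  assumes "orthogonal_transformation g" "w = (\<lambda>x. g x + l)" "l \<in> weight_lattice R" "g b \<in> R"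
  shows "\<exists>m. carries w b (g b) m"
proof -
  have "l \<bullet> coroot (g b) \<in> \<int>" using assms by (simp add: weight_lattice_def)
  then obtain m :: int where "l \<bullet> coroot (g b) = of_int m" by (auto elim: Ints_cases)
  then have "carries w b (g b) m" using assms(1)
    by (auto simp: carries_def assms(2) inner_add_left coroot_orthogonal)
      (auto simp: orthogonal_transformation_def linear_add linear_scale)
  then show ?thesis ..
qed

lemma carries_to:
  assumes "w \<in> W" "a \<in> R"
  obtains b m where "b \<in> R" "carries w b a m"
proof -
  obtain g l where gl: "orthogonal_transformation g" "g ` R = R" "l \<in> weight_lattice R"
    "w = (\<lambda>x. g x + l)" using ext_weyl_form assms by blast
  obtain b where b: "b \<in> R" "g b = a" using gl(2) assms(2) by (metis imageE)
  then show ?thesis using carries_form[OF gl(1,4,3), of b] assms(2) that by auto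
qed

lemma carries_from:
  assumes "w \<in> W" "b \<in> R"
  obtains a m where "a \<in> R" "carries w b a m"
proof -
  obtain g l where gl: "orthogonal_transformation g" "g ` R = R" "l \<in> weight_lattice R"
    "w = (\<lambda>x. g x + l)" using ext_weyl_form assms by blast
  have "g b \<in> R" using gl(2) assms(2) by (metis imageI)
  then show ?thesis using carries_form[OF gl(1,4,3), of b] that by auto
qed

lemma ext_weyl_weight_lattice:
  assumes "w \<in> W" "x \<in> weight_lattice R"
  shows "w x \<in> weight_lattice R"
proof -
  obtain g l where gl: "orthogonal_transformation g" "g ` R = R" "l \<in> weight_lattice R"
    "w = (\<lambda>x. g x + l)" using ext_weyl_form assms by blast
  show ?thesis
    unfolding gl(4) by (rule weight_lattice_add[OF orthogonal_weight_lattice[OF gl(1,2) assms(2)] gl(3)])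
qed

lemma carries_side:
  "carries w b a m \<Longrightarrow> w x \<bullet> coroot a - of_int k = x \<bullet> coroot b - of_int (k - m)"
  by (simp add: carries_def)

lemma carries_sep: "carries w b a m \<Longrightarrow> sep a k (w x) (w y) = sep b (k - m) x y"
  unfolding sep_def carries_side ..

lemma carries_hyperpl: "carries w b a m \<Longrightarrow> w x \<in> hyperpl a k \<longleftrightarrow> x \<in> hyperpl b (k - m)"
  using carries_side[of w b a m x k] by (auto simp: hyperpl_def)

subsection \<open>Positive roots and the alcove\<close>

lemma S_subset: "S \<subseteq> R" and independent_S: "independent S"
  using base by (auto simp: is_base_def)

lemma finite_S: "finite S"
  using S_subset finite_R finite_subset by blast

lemma pos_root_in: "a \<in> Rp \<Longrightarrow> a \<in> R"
  by (simp add: pos_roots_def)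

lemma pos_rootI:
  fixes c :: "'a \<Rightarrow> int"
  shows "a \<in> R \<Longrightarrow> a = (\<Sum>b\<in>S. of_int (c b) *\<^sub>R b) \<Longrightarrow> (\<And>b. b \<in> S \<Longrightarrow> 0 \<le> c b) \<Longrightarrow> a \<in> Rp"
  by (auto simp: pos_roots_def)

lemma pos_root_cases:
  assumes "a \<in> R"
  shows "a \<in> Rp \<or> - a \<in> Rp"
proof -
  obtain c :: "'a \<Rightarrow> int" where c: "a = (\<Sum>b\<in>S. of_int (c b) *\<^sub>R b)"
    "(\<forall>b\<in>S. c b \<ge> 0) \<or> (\<forall>b\<in>S. c b \<le> 0)"
    using base assms unfolding is_base_def by blast
  have "- a = (\<Sum>b\<in>S. of_int (- c b) *\<^sub>R b)" by (subst c(1)) (simp add: sum_negf)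
  moreover have "- a \<in> R" using assms uminus_root by blast
  moreover have "(\<forall>b\<in>S. c b \<ge> 0) \<or> (\<forall>b\<in>S. - c b \<ge> 0)" using c(2) by simp
  ultimately show ?thesis
    using c(1) assms pos_rootI[of a c] pos_rootI[of "- a" "\<lambda>b. - c b"] by auto
qed

lemma S_pos: "S \<subseteq> Rp"
proof
  fix a assume a: "a \<in> S"
  define c :: "'a \<Rightarrow> int" where "c b = (if b = a then 1 else 0)" for b
  have "a = (\<Sum>b\<in>S. of_int (c b) *\<^sub>R b)"
    using a finite_S
      by (simp add: c_def if_distrib[of of_int] if_distrib[of "\<lambda>c. c *\<^sub>R _"] cong: if_cong)
  moreover have "0 \<le> c b" for b by (simp add: c_def)
  ultimately show "a \<in> Rp" using a S_subset by (intro pos_rootI[of a c]) auto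
qed

lemma pos_root_nonneg:
  assumes "b \<in> Rp" "\<And>a. a \<in> S \<Longrightarrow> 0 \<le> x \<bullet> coroot a"
  shows "0 \<le> x \<bullet> coroot b"
proof -
  obtain c :: "'a \<Rightarrow> int" where c: "b = (\<Sum>a\<in>S. of_int (c a) *\<^sub>R a)" "\<forall>a\<in>S. c a \<ge> 0"
    using assms by (auto simp: pos_roots_def)
  have "0 \<le> x \<bullet> a" if "a \<in> S" for a
    using assms that inner_coroot_pos_iff[of a x] root_nonzero S_subset by blast
  then have "0 \<le> (\<Sum>a\<in>S. of_int (c a) * (x \<bullet> a))" using c by (intro sum_nonneg) auto
  also have "\<dots> = x \<bullet> b" by (subst c(1)) (simp add: inner_sum_right)
  finally show ?thesis using inner_coroot_pos_iff[of b x] root_nonzero pos_root_in assms by blast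
qed

lemma pos_root_positive:
  assumes "b \<in> Rp" "\<And>a. a \<in> S \<Longrightarrow> 0 < x \<bullet> coroot a"
  shows "0 < x \<bullet> coroot b"
proof -
  obtain c :: "'a \<Rightarrow> int" where c: "b = (\<Sum>a\<in>S. of_int (c a) *\<^sub>R a)" "\<forall>a\<in>S. c a \<ge> 0"
    using assms by (auto simp: pos_roots_def)
  have b: "b \<noteq> 0" using assms root_nonzero pos_root_in by blast
  have p: "0 < x \<bullet> a" if "a \<in> S" for a
    using assms that inner_coroot_pos_iff[of a x] root_nonzero S_subset by blast
  obtain d where d: "d \<in> S" "c d \<noteq> 0"
    using b c by (metis (no_types, lifting) of_int_0 scaleR_zero_left sum.neutral)
  then have "0 < (\<Sum>a\<in>S. of_int (c a) * (x \<bullet> a))"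
    using c p finite_S by (intro sum_pos2[of S d]) (auto simp: less_le intro!: mult_nonneg_nonneg)
  also have "\<dots> = x \<bullet> b" by (subst c(1)) (simp add: inner_sum_right)
  finally show ?thesis using inner_coroot_pos_iff[of b x] b by blast
qed

lemma alcove_nonempty: "alcove R S \<noteq> {}"
proof -
  obtain g :: "'a \<Rightarrow> real" where g: "linear g" "\<And>a. a \<in> S \<Longrightarrow> g a = 1"
    using linear_independent_extend[OF independent_S, of "\<lambda>_. 1 :: real"] by auto
  \<comment> \<open>The vector representing \<open>g\<close>: it pairs to 1 with every simple root,
    hence is strictly dominant.\<close>
  define x where "x = adjoint g 1"
  have x: "0 < x \<bullet> coroot a" if "a \<in> S" for a
  proof -
    have "a \<bullet> x = 1" using adjoint_works[OF g(1), of a 1] g(2) that by (simp add: x_def)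
    then show ?thesis using inner_coroot_pos_iff[of a x] that S_subset root_nonzero
      by (metis inner_commute subsetD zero_less_one)
  qed
  have fin: "finite Rp" using finite_R by (simp add: pos_roots_def)
  \<comment> \<open>Larger than every single pairing, so that dividing by it pushes them all below
    1.\<close>
  define M where "M = (\<Sum>b\<in>Rp. x \<bullet> coroot b) + 1"
  have pos: "0 < x \<bullet> coroot b" if "b \<in> Rp" for b using pos_root_positive that x by blast
  have le: "x \<bullet> coroot b < M" if "b \<in> Rp" for b
    using member_le_sum[OF that, of "\<lambda>b. x \<bullet> coroot b"] pos fin
      by (force simp: M_def less_imp_le)
  have "0 < M" using sum_nonneg[of Rp "\<lambda>b. x \<bullet> coroot b"] pos by (force simp: M_def less_imp_le)
  then have "(1 / M) *\<^sub>R x \<in> alcove R S" using pos le by (simp add: alcove_def)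
  then show ?thesis by blast
qed

text \<open>A point standing for the whole alcove: no reflection hyperplane meets an image of the
  alcove, so separation of alcoves can be tested on the points \<open>w x0\<close>.\<close>

definition x0 :: 'a where "x0 = (SOME x. x \<in> alcove R S)"

lemma x0_alcove: "x0 \<in> alcove R S"
  using alcove_nonempty by (simp add: x0_def some_in_eq)

lemma x0_pos: "a \<in> Rp \<Longrightarrow> 0 < x0 \<bullet> coroot a" and x0_less_1: "a \<in> Rp \<Longrightarrow> x0 \<bullet> coroot a < 1"
  using x0_alcove by (auto simp: alcove_def)

lemma a0_pos: "a0 \<in> Rp"
  using highest by (simp add: highest_coroot_root_def)

lemma highest_le:
  assumes "b \<in> R" "\<And>a. a \<in> S \<Longrightarrow> 0 \<le> x \<bullet> coroot a"
  shows "x \<bullet> coroot b \<le> x \<bullet> coroot a0"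
proof -
  obtain c :: "'a \<Rightarrow> int" where c: "\<forall>a\<in>S. c a \<ge> 0"
    "coroot a0 - coroot b = (\<Sum>a\<in>S. of_int (c a) *\<^sub>R coroot a)"
    using highest assms unfolding highest_coroot_root_def by blast
  have "x \<bullet> (coroot a0 - coroot b) = (\<Sum>a\<in>S. of_int (c a) * (x \<bullet> coroot a))"
    by (simp add: c inner_sum_right)
  also have "\<dots> \<ge> 0" using c assms by (intro sum_nonneg) auto
  finally show ?thesis by (simp add: inner_diff_right)
qed

lemma highest_less:
  assumes "b \<in> R" "b \<noteq> a0"
  shows "x0 \<bullet> coroot b < x0 \<bullet> coroot a0"
proof -
  obtain c :: "'a \<Rightarrow> int" where c: "\<forall>a\<in>S. c a \<ge> 0"
    "coroot a0 - coroot b = (\<Sum>a\<in>S. of_int (c a) *\<^sub>R coroot a)"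
    using highest assms unfolding highest_coroot_root_def by blast
  have "coroot a0 - coroot b \<noteq> 0" using assms(2) by (simp add: coroot_inject)
  then obtain d where d: "d \<in> S" "c d \<noteq> 0"
    using c by (metis (no_types, lifting) of_int_0 scaleR_zero_left sum.neutral)
  have "x0 \<bullet> (coroot a0 - coroot b) = (\<Sum>a\<in>S. of_int (c a) * (x0 \<bullet> coroot a))"
    by (simp add: c inner_sum_right)
  also have "\<dots> > 0"
    using c d x0_pos S_pos finite_S
    by (intro sum_pos2[of S d]) (auto simp: less_le intro!: mult_nonneg_nonneg)
  finally show ?thesis by (simp add: inner_diff_right)
qed

text \<open>The reflection changes only the coefficient at \<open>b\<close>. Some other coefficient
  of \<open>a\<close> is positive, survives, and by independence of \<open>S\<close> decides the
  sign of the whole root.\<close>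

lemma simple_refl_pos:
  assumes "b \<in> S" "a \<in> Rp" "a \<noteq> b"
  shows "refl_aff b 0 a \<in> Rp"
proof -
  obtain c :: "'a \<Rightarrow> int" where c: "a = (\<Sum>d\<in>S. of_int (c d) *\<^sub>R d)" "\<forall>d\<in>S. c d \<ge> 0"
    using assms by (auto simp: pos_roots_def)
  have bR: "b \<in> R" and aR: "a \<in> R" using assms S_subset pos_root_in by auto
  \<comment> \<open>Otherwise \<open>a\<close> is a nonnegative multiple of \<open>b\<close>, and
    reducedness forces \<open>a = b\<close>.\<close>
  obtain d where d: "d \<in> S" "d \<noteq> b" "c d \<noteq> 0"
  proof (rule ccontr)
    assume "\<not> thesis"
    then have "a = (\<Sum>d\<in>{b}. of_int (c d) *\<^sub>R d)"
      using that assms finite_S by (subst c(1), intro sum.mono_neutral_right) auto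
    then have a: "a = of_int (c b) *\<^sub>R b" by simp
    then have "of_int (c b) = (1::real) \<or> of_int (c b) = (-1::real)"
      using proportional[OF bR] aR by metis
    moreover have "(0::real) \<le> of_int (c b)" using c assms by simp
    ultimately have "of_int (c b) = (1::real)" by linarith
    then show False using a assms by simp
  qed
  obtain n :: int where n: "a \<bullet> coroot b = of_int n" using integral[OF bR aR] by (auto elim: Ints_cases)
  define c' where "c' = c(b := c b - n)"
  have "refl_aff b 0 a = (\<Sum>d\<in>S. of_int (c d) *\<^sub>R d) - of_int n *\<^sub>R b"
    unfolding refl_aff_def n by (simp add: c(1)[symmetric])
  also have "\<dots> = (\<Sum>d\<in>S. of_int (c' d) *\<^sub>R d)"
    using sum.remove[OF finite_S assms(1), of "\<lambda>d. of_int (c d) *\<^sub>R d"]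
      sum.remove[OF finite_S assms(1), of "\<lambda>d. of_int (c' d) *\<^sub>R d"]
    by (simp add: c'_def algebra_simps)
  finally have r: "refl_aff b 0 a = (\<Sum>d\<in>S. of_int (c' d) *\<^sub>R d)" .
  have rR: "refl_aff b 0 a \<in> R" using refl_root bR aR by blast
  then obtain e :: "'a \<Rightarrow> int" where e: "refl_aff b 0 a = (\<Sum>d\<in>S. of_int (e d) *\<^sub>R d)"
    "(\<forall>d\<in>S. e d \<ge> 0) \<or> (\<forall>d\<in>S. e d \<le> 0)"
    using base unfolding is_base_def by blast
  have "(\<Sum>x\<in>S. (of_int (e x) - of_int (c' x) :: real) *\<^sub>R x) = 0"
    using r e(1) by (simp add: scaleR_left_diff_distrib sum_subtractf)
  then have "of_int (e d) - of_int (c' d) = (0::real)"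
    using independentD[OF independent_S finite_S order_refl, of "\<lambda>x. of_int (e x) - of_int (c' x)"] d
      by blast
  then have "e d = c d" using d by (simp add: c'_def)
  then have "0 < e d" using c(2) d by force
  then have "\<forall>d\<in>S. e d \<ge> 0" using e(2) d by force
  then show ?thesis using rR e(1) pos_rootI by blast
qed

text \<open>This is where maximality of the coroot of \<open>a0\<close> enters: were the pairing at least two,
  reflecting \<open>b\<close> in \<open>a0\<close> would produce, up to sign, a coroot exceeding that of \<open>a0\<close>.\<close>

lemma highest_pairing:
  assumes "b \<in> Rp" "b \<noteq> a0"
  shows "a0 \<bullet> coroot b = 0 \<or> a0 \<bullet> coroot b = 1"
proof -
  have bR: "b \<in> R" and aR: "a0 \<in> R" using assms a0_pos pos_root_in by auto
  have S0: "0 \<le> x0 \<bullet> coroot a" if "a \<in> S" for a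
    using that S_pos x0_pos by (auto intro: less_imp_le)
  obtain n :: int where n: "a0 \<bullet> coroot b = of_int n"
    using integral[OF bR aR] by (auto elim: Ints_cases)
  have co: "coroot (refl_aff c 0 d) = coroot d - (coroot d \<bullet> coroot c) *\<^sub>R c" if "c \<in> R" for c d
    using coroot_orthogonal[OF orthogonal_refl_aff[OF root_nonzero[OF that]]] by (simp add: refl_aff_def)
  \<comment> \<open>Both sides equal the same multiple of \<open>d\<close>; this turns a reflected
    coroot back into a combination of coroots, to be compared at \<open>x0\<close>.\<close>
  have sw: "(coroot c \<bullet> coroot d) *\<^sub>R d = (coroot c \<bullet> d) *\<^sub>R coroot d" for c d :: 'a
    by (simp add: coroot_def)
  \<comment> \<open>Reflecting \<open>a0\<close> in \<open>b\<close> cannot raise its coroot, which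
    gives the lower bound on the pairing.\<close>
  have "x0 \<bullet> coroot (refl_aff b 0 a0) \<le> x0 \<bullet> coroot a0"
    using highest_le[OF refl_root[OF bR aR]] S0 by blast
  then have "0 \<le> (coroot a0 \<bullet> b) * (x0 \<bullet> coroot b)"
    by (simp add: co[OF bR] sw inner_diff_right)
  then have "0 \<le> coroot a0 \<bullet> b" using x0_pos[OF assms(1)] by (simp add: zero_le_mult_iff)
  then have "0 \<le> a0 \<bullet> b"
    using inner_coroot_pos_iff(2)[of a0 b] root_nonzero[OF aR] by (simp add: inner_commute)
  then have n0: "0 \<le> n" using inner_coroot_pos_iff(2)[of b a0] root_nonzero[OF bR] n by simp
  have "n < 2"
  proof (rule ccontr)
    assume "\<not> n < 2"
    then have n2: "(1::real) \<le> of_int n - 1" by linarith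
    have "x0 \<bullet> coroot (- refl_aff a0 0 b) \<le> x0 \<bullet> coroot a0"
      using highest_le[OF uminus_root[OF refl_root[OF aR bR]]] S0 by blast
    then have "(coroot b \<bullet> a0) * (x0 \<bullet> coroot a0) - x0 \<bullet> coroot b \<le> x0 \<bullet> coroot a0"
      by (simp add: coroot_minus co[OF aR] sw inner_diff_right)
    then have "(of_int n - 1) * (x0 \<bullet> coroot a0) \<le> x0 \<bullet> coroot b"
      using n by (simp add: inner_commute algebra_simps)
    moreover have "x0 \<bullet> coroot a0 \<le> (of_int n - 1) * (x0 \<bullet> coroot a0)"
      using mult_right_mono[OF n2, of "x0 \<bullet> coroot a0"] x0_pos[OF a0_pos] by simp
    ultimately show False using highest_less[OF bR assms(2)] by linarith
  qed
  then have "n = 0 \<or> n = 1" using n0 by linarith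
  then show ?thesis using n by auto
qed

lemma root_side:
  assumes "a \<in> R" "x \<in> alcove R S" "y \<in> alcove R S"
  shows "0 < (x \<bullet> coroot a - of_int k) * (y \<bullet> coroot a - of_int k)"
proof -
  have *: "0 < (x \<bullet> coroot b - of_int k) * (y \<bullet> coroot b - of_int k)" if "b \<in> Rp" for b k
    using that assms no_int_between[of 0 "x \<bullet> coroot b" "y \<bullet> coroot b" k]
      by (auto simp: alcove_def)
  from pos_root_cases[OF assms(1)] show ?thesis
  proof
    assume "- a \<in> Rp"
    from *[OF this, of "- k"] show ?thesis by (simp add: coroot_minus algebra_simps)
  qed (use * in blast)
qed

definition calcove :: "'a set" where
  "calcove = {y. \<forall>b\<in>Rp. 0 \<le> y \<bullet> coroot b \<and> y \<bullet> coroot b \<le> 1}"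

lemma calcove_not_sep:
  assumes "a \<in> R" "y \<in> calcove"
  shows "\<not> sep a k x0 y"
proof -
  have *: "\<not> sep b k x0 y" if b: "b \<in> Rp" for b k
  proof (cases "k \<le> 0")
    case True
    then have "of_int k \<le> (0::real)" by simp
    then show ?thesis using b x0_pos[OF b] assms(2)
      unfolding sep_def calcove_def by (auto simp: not_less intro!: mult_nonneg_nonneg)
  next
    case False
    then have "(1::real) \<le> of_int k" by linarith
    then show ?thesis using b x0_less_1[OF b] assms(2)
      unfolding sep_def calcove_def by (auto simp: not_less intro!: mult_nonpos_nonpos)
  qed
  from pos_root_cases[OF assms(1)] show ?thesis
    using * sep_minus[of a k] by metis
qed

end

subsection \<open>Separating hyperplanes\<close>

text \<open>Constant sign is assumed, rather than a strict side, so that the singleton in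
  \<open>chi\<close> may lie on the hyperplane.\<close>

lemma separates_iff_sep:
  assumes "x1 \<in> X" "y1 \<in> Y"
    and "\<And>x. x \<in> X \<Longrightarrow> sgn (x \<bullet> coroot a - of_int k) = sgn (x1 \<bullet> coroot a - of_int k)"
    and "\<And>y. y \<in> Y \<Longrightarrow> sgn (y \<bullet> coroot a - of_int k) = sgn (y1 \<bullet> coroot a - of_int k)"
  shows "separates a k X Y \<longleftrightarrow> sep a k x1 y1"
proof
  assume "separates a k X Y"
  then have "(x1 \<bullet> coroot a < of_int k \<and> y1 \<bullet> coroot a > of_int k) \<or>
    (x1 \<bullet> coroot a > of_int k \<and> y1 \<bullet> coroot a < of_int k)"
    using assms(1,2) unfolding separates_def by blast
  then show "sep a k x1 y1" by (auto simp: sep_def mult_less_0_iff)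
next
  assume "sep a k x1 y1"
  then consider "x1 \<bullet> coroot a < of_int k" "y1 \<bullet> coroot a > of_int k"
    | "x1 \<bullet> coroot a > of_int k" "y1 \<bullet> coroot a < of_int k"
    by (auto simp: sep_def mult_less_0_iff)
  then show "separates a k X Y"
  proof cases
    case 1
    then have "x \<bullet> coroot a < of_int k" if "x \<in> X" for x
      using assms(3)[OF that] by (simp add: sgn_if split: if_splits)
    moreover have "y \<bullet> coroot a > of_int k" if "y \<in> Y" for y
      using assms(4)[OF that] 1 by (simp add: sgn_if split: if_splits)
    ultimately show ?thesis by (simp add: separates_def)
  next
    case 2
    then have "x \<bullet> coroot a > of_int k" if "x \<in> X" for x
      using assms(3)[OF that] by (simp add: sgn_if split: if_splits)
    moreover have "y \<bullet> coroot a < of_int k" if "y \<in> Y" for y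
      using assms(4)[OF that] 2 by (simp add: sgn_if split: if_splits)
    ultimately show ?thesis by (simp add: separates_def)
  qed
qed

lemma sgn_eq_of_mult_pos: "0 < (u::real) * v \<Longrightarrow> sgn u = sgn v"
  by (auto simp: zero_less_mult_iff sgn_if)

context root_datum
begin

text \<open>A set of hyperplanes and not of pairs: \<open>(a, k)\<close> and
  \<open>(- a, - k)\<close> name the same hyperplane and must count once, as in
  \<open>len\<close>.\<close>

definition Sep :: "'a \<Rightarrow> 'a \<Rightarrow> 'a set set" where
  "Sep x y = {hyperpl a k | a k. a \<in> R \<and> sep a k x y}"

lemma hyperpl_in_Sep:
  assumes "a \<in> R"
  shows "hyperpl a k \<in> Sep x y \<longleftrightarrow> sep a k x y"
proof
  assume "hyperpl a k \<in> Sep x y"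
  then obtain b m where "b \<in> R" "sep b m x y" "hyperpl a k = hyperpl b m" by (auto simp: Sep_def)
  then show "sep a k x y" using hyperpl_eq_sep root_nonzero assms by metis
qed (use assms in \<open>auto simp: Sep_def\<close>)

lemma Sep_commute: "Sep x y = Sep y x"
  by (simp add: Sep_def sep_commute)

lemma finite_Sep: "finite (Sep x y)"
proof -
  have "Sep x y \<subseteq> (\<Union>a\<in>R. hyperpl a ` {k. sep a k x y})" by (auto simp: Sep_def)
  moreover have "finite (\<Union>a\<in>R. hyperpl a ` {k. sep a k x y})"
    using finite_R by (auto simp: sep_def finite_int_between)
  ultimately show ?thesis by (rule finite_subset)
qed

lemma card_Sep_le:
  assumes "w \<in> W"
  shows "card (Sep x y) \<le> card (Sep (w x) (w y))"
proof (rule card_inj_on_le)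
  show "inj_on ((`) w) (Sep x y)"
    using bij_ext_weyl[OF assms] by (auto intro!: inj_onI simp: inj_image_eq_iff bij_is_inj)
  show "(`) w ` Sep x y \<subseteq> Sep (w x) (w y)"
  proof (rule image_subsetI)
    fix H assume "H \<in> Sep x y"
    then obtain b k where b: "b \<in> R" "sep b k x y" "H = hyperpl b k" by (auto simp: Sep_def)
    obtain a m where a: "a \<in> R" "carries w b a m" using carries_from assms b by blast
    have "w ` H = hyperpl a (k + m)"
    proof
      show "w ` H \<subseteq> hyperpl a (k + m)" using carries_hyperpl[OF a(2), of _ "k + m"] b by auto
      show "hyperpl a (k + m) \<subseteq> w ` H"
      proof
        fix z assume z: "z \<in> hyperpl a (k + m)"
        obtain z' where "z = w z'" using bij_ext_weyl[OF assms] by (metis bij_pointE)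
        then show "z \<in> w ` H" using carries_hyperpl[OF a(2), of z' "k + m"] b z by auto
      qed
    qed
    moreover have "sep a (k + m) (w x) (w y)" using carries_sep[OF a(2), of "k + m"] b by simp
    ultimately show "w ` H \<in> Sep (w x) (w y)" using a by (simp add: hyperpl_in_Sep)
  qed
qed (rule finite_Sep)

lemma card_Sep_ext_weyl:
  assumes "w \<in> W"
  shows "card (Sep (w x) (w y)) = card (Sep x y)"
proof -
  have "inv w (w z) = z" for z using bij_ext_weyl[OF assms] by (simp add: bij_is_inj)
  then show ?thesis
    using card_Sep_le[OF assms, of x y] card_Sep_le[OF ext_weyl_inv[OF assms], of "w x" "w y"] by simp
qed

lemma ext_weyl_side:
  assumes "w \<in> W" "a \<in> R" "x \<in> alcove R S" "y \<in> alcove R S"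
  shows "0 < (w x \<bullet> coroot a - of_int k) * (w y \<bullet> coroot a - of_int k)"
proof -
  obtain b m where b: "b \<in> R" "carries w b a m" using carries_to assms by blast
  show ?thesis unfolding carries_side[OF b(2)] using root_side[OF b(1) assms(3,4)] by blast
qed

lemma ext_weyl_generic:
  assumes "w \<in> W" "a \<in> R"
  shows "w x0 \<bullet> coroot a \<noteq> of_int k"
  using ext_weyl_side[OF assms x0_alcove x0_alcove, of k] by auto

lemma x0_generic: "a \<in> R \<Longrightarrow> x0 \<bullet> coroot a \<noteq> of_int k"
  using ext_weyl_generic[OF ext_weyl.ew_id] by simp

lemma len_eq_card_Sep:
  assumes "w \<in> W"
  shows "len R S w = card (Sep x0 (w x0))"
proof -
  have "separates a k (alcove R S) (w ` alcove R S) \<longleftrightarrow> sep a k x0 (w x0)" if "a \<in> R" for a k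
    using root_side[OF that _ x0_alcove] ext_weyl_side[OF assms that _ x0_alcove] x0_alcove
    by (intro separates_iff_sep) (auto intro: sgn_eq_of_mult_pos)
  then have "{H. \<exists>a\<in>R. \<exists>k. H = hyperpl a k \<and> separates a k (alcove R S) (w ` alcove R S)} = Sep x0 (w x0)"
    unfolding Sep_def by blast
  then show ?thesis by (simp add: len_def)
qed

text \<open>The middle point must avoid every hyperplane, since strict separation can be lost at a
  point of a wall; images of \<open>x0\<close> qualify.\<close>

lemma Sep_triangle:
  assumes "w \<in> W"
  shows "Sep x z \<subseteq> Sep x (w x0) \<union> Sep (w x0) z"
proof
  fix H assume "H \<in> Sep x z"
  then obtain a k where a: "a \<in> R" "sep a k x z" "H = hyperpl a k" by (auto simp: Sep_def)
  have "w x0 \<bullet> coroot a \<noteq> of_int k" using ext_weyl_generic assms a by blast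
  then have "sep a k x (w x0) \<or> sep a k (w x0) z"
    using a(2) by (auto simp: sep_def mult_less_0_iff)
  then show "H \<in> Sep x (w x0) \<union> Sep (w x0) z" using a by (auto simp: hyperpl_in_Sep)
qed

lemma len_comp_le:
  assumes "v \<in> W" "w \<in> W"
  shows "len R S (v \<circ> w) \<le> len R S v + len R S w"
proof -
  have "len R S (v \<circ> w) = card (Sep x0 (v (w x0)))"
    using assms by (simp add: len_eq_card_Sep ext_weyl_comp)
  also have "\<dots> \<le> card (Sep x0 (v x0) \<union> Sep (v x0) (v (w x0)))"
    by (intro card_mono Sep_triangle assms) (simp add: finite_Sep)
  also have "\<dots> \<le> card (Sep x0 (v x0)) + card (Sep (v x0) (v (w x0)))" by (rule card_Un_le)
  also have "\<dots> = len R S v + len R S w" using assms by (simp add: len_eq_card_Sep card_Sep_ext_weyl)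
  finally show ?thesis .
qed

lemma len_inv:
  assumes "w \<in> W"
  shows "len R S (inv w) = len R S w"
proof -
  have "w (inv w x0) = x0" using bij_ext_weyl[OF assms] by (simp add: bij_is_surj surj_f_inv_f)
  then have "card (Sep x0 (inv w x0)) = card (Sep (w x0) x0)"
    using card_Sep_ext_weyl[OF assms, of x0 "inv w x0"] by simp
  then show ?thesis using assms by (simp add: len_eq_card_Sep ext_weyl_inv Sep_commute)
qed

subsection \<open>Affine simple reflections\<close>

lemma aff_simple_pos: "(b, m) \<in> aff_simple S a0 \<Longrightarrow> b \<in> Rp"
  using S_pos a0_pos by (auto simp: aff_simple_def)

lemma aff_simple_root: "(b, m) \<in> aff_simple S a0 \<Longrightarrow> b \<in> R"
  using aff_simple_pos pos_root_in by blast

lemma aff_simple_nonzero: "(b, m) \<in> aff_simple S a0 \<Longrightarrow> b \<noteq> 0"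
  using aff_simple_root root_nonzero by blast

lemma refl_aff_simple_in:
  assumes "(b, m) \<in> aff_simple S a0"
  shows "refl_aff b m \<in> W"
proof -
  have b: "b \<in> R" using assms aff_simple_root by blast
  have "m = 0 \<or> m = 1" using assms by (auto simp: aff_simple_def)
  moreover have "refl_aff b 1 = transl b \<circ> refl_aff b 0"
    by (auto simp: fun_eq_iff refl_aff_def transl_def algebra_simps)
  ultimately show ?thesis
    using ext_weyl.ew_transl[OF refl_aff_in_ext_weyl[OF b] root_in_weight_lattice[OF b]]
      refl_aff_in_ext_weyl[OF b] by auto
qed

text \<open>The alcove and its image under a simple reflection are separated by their common wall
  only. For a simple root, the reflection permutes the other positive roots, whose coroots therefore
  stay between 0 and 1; for \<open>a0\<close>, the possible pairings 0 and 1 give the same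
  bound.\<close>

lemma aff_simple_sep_pos:
  assumes "(b, m) \<in> aff_simple S a0" "a \<in> Rp" "sep a k x0 (refl_aff b m x0)"
  shows "a = b \<and> k = m"
proof -
  have aR: "a \<in> R" and a0R: "a0 \<in> R" using assms pos_root_in a0_pos by auto
  have sp: "(x0 \<bullet> coroot a - of_int k) * (refl_aff b m x0 \<bullet> coroot a - of_int k) < 0"
    using assms(3) by (simp add: sep_def)
  have not01: "\<not> (0 < refl_aff b m x0 \<bullet> coroot a \<and> refl_aff b m x0 \<bullet> coroot a < 1)"
    using no_int_between[of 0 "x0 \<bullet> coroot a" "refl_aff b m x0 \<bullet> coroot a" k] sp
      x0_pos[OF assms(2)] x0_less_1[OF assms(2)] by auto
  consider "b \<in> S" "m = 0" | "b = a0" "m = 1" using assms(1) by (auto simp: aff_simple_def)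
  then show ?thesis
  proof cases
    case 1
    then have bR: "b \<in> R" using S_subset by blast
    have orth: "orthogonal_transformation (refl_aff b 0)" using orthogonal_refl_aff root_nonzero bR by blast
    have "a = b"
    proof (rule ccontr)
      assume "a \<noteq> b"
      then have p: "refl_aff b 0 a \<in> Rp" using simple_refl_pos 1 assms by blast
      have "refl_aff b 0 x0 \<bullet> coroot a = refl_aff b 0 x0 \<bullet> coroot (refl_aff b 0 (refl_aff b 0 a))"
        using refl_aff_involution root_nonzero bR by metis
      also have "\<dots> = x0 \<bullet> coroot (refl_aff b 0 a)"
        unfolding coroot_orthogonal[OF orth, of "refl_aff b 0 a"]
        using orth unfolding orthogonal_transformation_def by blast
      finally show False using not01 x0_pos[OF p] x0_less_1[OF p] 1 by simp
    qed
    moreover have "refl_aff b 0 x0 \<bullet> coroot b = - (x0 \<bullet> coroot b)"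
      using root_nonzero[OF bR] by (simp add: inner_refl_aff inner_coroot_self)
    ultimately have "k = 0"
      using unique_int_between[of 0 "x0 \<bullet> coroot a" "refl_aff b m x0 \<bullet> coroot a" k] sp
        x0_pos[OF assms(2)] x0_less_1[OF assms(2)] 1 by simp
    then show ?thesis using \<open>a = b\<close> 1 by simp
  next
    case 2
    have "a = a0"
    proof (rule ccontr)
      assume ne: "a \<noteq> a0"
      \<comment> \<open>With pairing 1 the new value is 1 minus the difference of the values of
        \<open>coroot a0\<close> and \<open>coroot a\<close> at \<open>x0\<close>, which lies
        strictly between 0 and 1.\<close>
      have "refl_aff b m x0 \<bullet> coroot a = x0 \<bullet> coroot a - (x0 \<bullet> coroot a0 - 1) * (a0 \<bullet> coroot a)"
        using 2 by (simp add: inner_refl_aff)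
      then show False
        using highest_pairing[OF assms(2) ne] not01 x0_pos[OF assms(2)] x0_less_1[OF assms(2)]
          x0_less_1[OF a0_pos] highest_less[OF aR ne] by auto
    qed
    \<comment> \<open>The reflected value lies between 1 and 2, so 1 is the only integer
      crossed.\<close>
    moreover have "refl_aff a0 1 x0 \<bullet> coroot a0 = 2 - x0 \<bullet> coroot a0"
      using root_nonzero[OF a0R] by (simp add: inner_refl_aff inner_coroot_self)
    ultimately have "k = 1"
      using unique_int_between[of 1 "refl_aff b m x0 \<bullet> coroot a" "x0 \<bullet> coroot a" k] sp
        x0_pos[OF assms(2)] x0_less_1[OF assms(2)] 2 by (simp add: mult.commute)
    then show ?thesis using \<open>a = a0\<close> 2 by simp
  qed
qed

lemma aff_simple_sep:
  assumes "(b, m) \<in> aff_simple S a0" "a \<in> R" "sep a k x0 (refl_aff b m x0)"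
  shows "(a = b \<and> k = m) \<or> (a = - b \<and> k = - m)"
  using pos_root_cases[OF assms(2)]
proof
  assume "- a \<in> Rp"
  then have "- a = b \<and> - k = m"
    using aff_simple_sep_pos[OF assms(1)] assms(3) sep_minus by blast
  then show ?thesis by auto
qed (use aff_simple_sep_pos[OF assms(1) _ assms(3)] in blast)

lemma sep_refl_aff:
  assumes "b \<noteq> 0"
  shows "sep b m (refl_aff b m x) y \<longleftrightarrow> y \<notin> hyperpl b m \<and> x \<notin> hyperpl b m \<and> \<not> sep b m x y"
proof -
  have "refl_aff b m x \<bullet> coroot b - of_int m = - (x \<bullet> coroot b - of_int m)"
    using assms by (simp add: inner_refl_aff inner_coroot_self)
  then show ?thesis by (auto simp: sep_def hyperpl_def mult_less_0_iff)
qed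

lemma sep_aff_simple_other:
  assumes "(b, m) \<in> aff_simple S a0" "a \<in> R" "hyperpl a k \<noteq> hyperpl b m"
  shows "sep a k (refl_aff b m x0) x = sep a k x0 x"
proof -
  have "\<not> sep a k x0 (refl_aff b m x0)"
    using aff_simple_sep[OF assms(1,2)] assms(3) hyperpl_minus by metis
  moreover have "x0 \<bullet> coroot a \<noteq> of_int k" "refl_aff b m x0 \<bullet> coroot a \<noteq> of_int k"
    using x0_generic ext_weyl_generic refl_aff_simple_in assms by blast+
  ultimately show ?thesis by (auto simp: sep_def mult_less_0_iff)
qed

text \<open>Moves the reflection from the arbitrary point \<open>x\<close> to the base point, where
  the affected hyperplane is known exactly.\<close>

lemma card_Sep_refl:
  assumes "(b, m) \<in> aff_simple S a0"
  shows "card (Sep x0 (refl_aff b m x)) = card (Sep (refl_aff b m x0) x)"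
  using card_Sep_ext_weyl[OF refl_aff_simple_in[OF assms], of x0 "refl_aff b m x"]
  by (simp add: refl_aff_involution[OF aff_simple_nonzero[OF assms]])

lemma Sep_refl_other:
  assumes "(b, m) \<in> aff_simple S a0"
  shows "Sep (refl_aff b m x0) x - {hyperpl b m} = Sep x0 x - {hyperpl b m}"
  using sep_aff_simple_other[OF assms] unfolding Sep_def by blast

text \<open>The point is arbitrary, not only an image of \<open>x0\<close>, because
  \<open>ext_weyl_calcove\<close> descends from every point of the space.\<close>

lemma Sep_refl_descend:
  assumes "(b, m) \<in> aff_simple S a0" "sep b m x0 x"
  shows "card (Sep x0 x) = Suc (card (Sep x0 (refl_aff b m x)))"
proof -
  have b: "b \<in> R" "b \<noteq> 0" using aff_simple_root aff_simple_nonzero assms by auto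
  have 1: "hyperpl b m \<in> Sep x0 x" using assms b by (simp add: hyperpl_in_Sep)
  have 2: "hyperpl b m \<notin> Sep (refl_aff b m x0) x"
    using assms b by (simp add: hyperpl_in_Sep sep_refl_aff)
  have "Sep (refl_aff b m x0) x = Sep x0 x - {hyperpl b m}" using Sep_refl_other[OF assms(1)] 2 by blast
  then show ?thesis
    using card.remove[OF finite_Sep 1] card_Sep_refl[OF assms(1)] by simp
qed

lemma Sep_refl_ascend:
  assumes "(b, m) \<in> aff_simple S a0" "\<not> sep b m x0 x" "x \<notin> hyperpl b m"
  shows "card (Sep x0 (refl_aff b m x)) = Suc (card (Sep x0 x))"
proof -
  have b: "b \<in> R" "b \<noteq> 0" using aff_simple_root aff_simple_nonzero assms by auto
  have "x0 \<notin> hyperpl b m" using x0_generic[OF b(1)] by (simp add: hyperpl_def)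
  then have 1: "hyperpl b m \<in> Sep (refl_aff b m x0) x"
    using assms b by (simp add: hyperpl_in_Sep sep_refl_aff)
  have 2: "hyperpl b m \<notin> Sep x0 x" using assms b by (simp add: hyperpl_in_Sep)
  have "Sep x0 x = Sep (refl_aff b m x0) x - {hyperpl b m}" using Sep_refl_other[OF assms(1)] 2 by blast
  then show ?thesis
    using card.remove[OF finite_Sep 1] card_Sep_refl[OF assms(1)] by simp
qed

text \<open>The simple walls alone cut out the closed alcove: simple roots control the sign on all
  positive roots, and for dominant points the highest coroot dominates all the others.\<close>

lemma calcoveI:
  assumes "\<And>b m. (b, m) \<in> aff_simple S a0 \<Longrightarrow> \<not> sep b m x0 x"
  shows "x \<in> calcove"
proof -
  have S: "0 \<le> x \<bullet> coroot b" if "b \<in> S" for b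
  proof -
    have "\<not> sep b 0 x0 x" using assms that by (simp add: aff_simple_def)
    then show ?thesis using x0_pos[of b] S_pos that by (auto simp: sep_def mult_less_0_iff)
  qed
  have "\<not> sep a0 1 x0 x" using assms by (simp add: aff_simple_def)
  then have "x \<bullet> coroot a0 \<le> 1" using x0_less_1[OF a0_pos] by (auto simp: sep_def mult_less_0_iff)
  then have "x \<bullet> coroot b \<le> 1" if "b \<in> Rp" for b
    using highest_le[OF pos_root_in[OF that] S] by linarith
  then show ?thesis
    unfolding calcove_def using pos_root_nonneg[of _ x] S by blast
qed

text \<open>A point outside the closed alcove is cut off from \<open>x0\<close> by a simple wall;
  reflecting in it removes one of the finitely many separating hyperplanes.\<close>

lemma ext_weyl_calcove: "\<exists>w\<in>W. \<exists>y\<in>calcove. x = w y"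
proof (induction "card (Sep x0 x)" arbitrary: x rule: less_induct)
  case less
  show ?case
  proof (cases "x \<in> calcove")
    case True
    then show ?thesis using ext_weyl.ew_id by (metis id_apply)
  next
    case False
    then obtain b m where b: "(b, m) \<in> aff_simple S a0" "sep b m x0 x" using calcoveI by blast
    obtain w y where w: "w \<in> W" "y \<in> calcove" "refl_aff b m x = w y"
      using less[of "refl_aff b m x"] Sep_refl_descend[OF b] by auto
    have "x = (refl_aff b m \<circ> w) y"
      using refl_aff_involution[OF aff_simple_nonzero[OF b(1)], of m x] w by simp
    then show ?thesis using w ext_weyl_comp[OF refl_aff_simple_in[OF b(1)] w(1)] by blast
  qed
qed

section \<open>Length through walls, and the folding condition\<close>

lemma len_refl:
  assumes "(b, m) \<in> aff_simple S a0" "w \<in> W"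
  shows "if sep b m x0 (w x0) then len R S w = Suc (len R S (refl_aff b m \<circ> w))
    else len R S (refl_aff b m \<circ> w) = Suc (len R S w)"
proof -
  have "w x0 \<notin> hyperpl b m"
    using ext_weyl_generic[OF assms(2) aff_simple_root[OF assms(1)]] by (simp add: hyperpl_def)
  then show ?thesis
    using Sep_refl_descend[OF assms(1)] Sep_refl_ascend[OF assms(1)]
      len_eq_card_Sep[OF assms(2)] len_eq_card_Sep[OF ext_weyl_comp[OF refl_aff_simple_in[OF assms(1)] assms(2)]]
    by simp
qed

lemma len_refl_less_iff:
  assumes "(b, m) \<in> aff_simple S a0" "w \<in> W"
  shows "len R S (refl_aff b m \<circ> w) < len R S w \<longleftrightarrow> sep b m x0 (w x0)"
  using len_refl[OF assms] by (auto split: if_splits)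

lemma Sep_empty_iff: "Sep x0 x = {} \<longleftrightarrow> x \<in> calcove"
proof
  assume "Sep x0 x = {}"
  then show "x \<in> calcove" using calcoveI hyperpl_in_Sep aff_simple_root by (metis empty_iff)
qed (use calcove_not_sep in \<open>auto simp: Sep_def\<close>)

lemma len_descent:
  assumes "w \<in> W" "len R S w \<noteq> 0"
  shows "\<exists>b m. (b, m) \<in> aff_simple S a0 \<and> len R S (refl_aff b m \<circ> w) < len R S w"
proof (rule ccontr)
  assume "\<not> ?thesis"
  then have "w x0 \<in> calcove" using calcoveI len_refl_less_iff assms(1) by blast
  then have "Sep x0 (w x0) = {}" using Sep_empty_iff by blast
  then show False using assms by (simp add: len_eq_card_Sep)
qed

text \<open>The wall of \<open>s\<close> separates the images of the alcove under \<open>w\<close>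
  and \<open>w \<circ> t\<close>. Pulled back by \<open>w\<close>, it separates the alcove from its
  reflection in the wall of \<open>t\<close>, so it is that wall, and \<open>w\<close> conjugates
  one reflection into the other.\<close>

lemma len_folding:
  assumes s: "(b, m) \<in> aff_simple S a0" and t: "(b', m') \<in> aff_simple S a0" and w: "w \<in> W"
    and up: "len R S w < len R S (refl_aff b m \<circ> w)"
    and down: "len R S (refl_aff b m \<circ> (w \<circ> refl_aff b' m')) < len R S (w \<circ> refl_aff b' m')"
  shows "refl_aff b m \<circ> w = w \<circ> refl_aff b' m'"
proof -
  have bR: "b \<in> R" using s aff_simple_root by blast
  have wt: "w \<circ> refl_aff b' m' \<in> W" using w t refl_aff_simple_in ext_weyl_comp by blast
  have "\<not> sep b m x0 (w x0)" using len_refl_less_iff[OF s w] up by simp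
  moreover have "sep b m x0 (w (refl_aff b' m' x0))" using len_refl_less_iff[OF s wt] down by simp
  moreover have "w x0 \<bullet> coroot b \<noteq> of_int m" using ext_weyl_generic w bR by blast
  ultimately have sp: "sep b m (w x0) (w (refl_aff b' m' x0))" by (auto simp: sep_def mult_less_0_iff)
  obtain c n where c: "c \<in> R" "carries w c b n" using carries_to w bR by blast
  have "sep c (m - n) x0 (refl_aff b' m' x0)" using sp carries_sep[OF c(2)] by blast
  then have "(c = b' \<and> m - n = m') \<or> (c = - b' \<and> m - n = - m')"
    using aff_simple_sep[OF t c(1)] by blast
  then have e: "refl_aff b' m' = refl_aff c (m - n)" using refl_aff_minus by metis
  show ?thesis
  proof
    fix x
    have "w (refl_aff c (m - n) x) = w (x + (- (x \<bullet> coroot c - of_int (m - n))) *\<^sub>R c)"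
      by (simp add: refl_aff_def algebra_simps)
    also have "\<dots> = w x + (- (x \<bullet> coroot c - of_int (m - n))) *\<^sub>R b"
      using c(2) unfolding carries_def by blast
    also have "\<dots> = refl_aff b m (w x)"
      unfolding refl_aff_def carries_side[OF c(2), of x m]
        by (simp only: scaleR_minus_left diff_conv_add_uminus)
    finally show "(refl_aff b m \<circ> w) x = (w \<circ> refl_aff b' m') x" by (simp add: e)
  qed
qed

lemma len_0_alcove:
  assumes "w \<in> W" "len R S w = 0"
  shows "w ` alcove R S \<subseteq> alcove R S"
proof -
  have e: "Sep x0 (w x0) = {}" using assms finite_Sep by (simp add: len_eq_card_Sep)
  have "w x \<in> alcove R S" if x: "x \<in> alcove R S" for x
  proof -
    have "0 < w x \<bullet> coroot b \<and> w x \<bullet> coroot b < 1" if b: "b \<in> Rp" for b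
    proof -
      have bR: "b \<in> R" using b pos_root_in by blast
      have *: "sgn (w x \<bullet> coroot b - of_int k) = sgn (x0 \<bullet> coroot b - of_int k)" for k
      proof -
        have "sgn (w x \<bullet> coroot b - of_int k) = sgn (w x0 \<bullet> coroot b - of_int k)"
          using ext_weyl_side[OF assms(1) bR x x0_alcove] sgn_eq_of_mult_pos by blast
        moreover have "\<not> sep b k x0 (w x0)" using e hyperpl_in_Sep[OF bR] by blast
        ultimately show ?thesis
          using x0_generic[OF bR, of k] ext_weyl_generic[OF assms(1) bR, of k]
          by (auto simp: sep_def sgn_if mult_less_0_iff split: if_splits)
      qed
      show ?thesis using *[of 0] *[of 1] x0_pos[OF b] x0_less_1[OF b]
        by (auto simp: sgn_if split: if_splits)
    qed
    then show ?thesis by (simp add: alcove_def)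
  qed
  then show ?thesis by blast
qed

text \<open>Length zero yields only an inclusion of alcoves; applied also to the inverse, again of
  length zero, it becomes equality.\<close>

lemma Omega_iff: "w \<in> Omega R S \<longleftrightarrow> w \<in> W \<and> len R S w = 0"
proof
  assume w: "w \<in> Omega R S"
  then have W: "w \<in> W" "w x0 \<in> alcove R S" using x0_alcove by (auto simp: Omega_def)
  have "w x0 \<in> calcove" using W(2) by (auto simp: alcove_def calcove_def intro: less_imp_le)
  then have "Sep x0 (w x0) = {}" using Sep_empty_iff by blast
  then show "w \<in> W \<and> len R S w = 0" using W by (simp add: len_eq_card_Sep)
next
  assume w: "w \<in> W \<and> len R S w = 0"
  have "alcove R S \<subseteq> w ` alcove R S"
  proof
    fix x assume "x \<in> alcove R S"
    then have "inv w x \<in> alcove R S"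
      using len_0_alcove[of "inv w"] w by (auto simp: len_inv ext_weyl_inv)
    then show "x \<in> w ` alcove R S"
      using bij_ext_weyl[of w] w by (intro image_eqI[of _ _ "inv w x"]) (auto simp: bij_is_surj surj_f_inv_f)
  qed
  then show "w \<in> Omega R S" using w len_0_alcove[of w] by (auto simp: Omega_def)
qed

end

section \<open>The difference-reflection representation\<close>

locale hecke_datum = root_datum R S a0 for R S :: "'a::euclidean_space set" and a0 +
  fixes q :: "('a \<Rightarrow> 'a) \<Rightarrow> real"
  assumes q_neq_0: "\<And>w. w \<in> ext_weyl R \<Longrightarrow> q w \<noteq> 0"
    and q_mult: "\<And>v w. v \<in> ext_weyl R \<Longrightarrow> w \<in> ext_weyl R \<Longrightarrow>
      len R S (v \<circ> w) = len R S v + len R S w \<Longrightarrow> q (v \<circ> w) = q v * q w"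
    and q_len_0: "\<And>w. w \<in> ext_weyl R \<Longrightarrow> len R S w = 0 \<Longrightarrow> q w = 1"
begin

abbreviation refl_of :: "'a \<times> int \<Rightarrow> 'a \<Rightarrow> 'a" where
  "refl_of j \<equiv> refl_aff (fst j) (snd j)"

sublocale hecke_group W "refl_of ` aff_simple S a0" "len R S" "\<lambda>w. complex_of_real (q w)"
proof
  show "id \<in> W" by (rule ext_weyl.ew_id)
  show "len R S id = 0"
  proof -
    have "x0 \<in> calcove" using x0_pos x0_less_1 by (auto simp: calcove_def intro: less_imp_le)
    then show ?thesis using len_eq_card_Sep[OF ext_weyl.ew_id] Sep_empty_iff[of x0] by simp
  qed
  show "\<exists>s\<in>refl_of ` aff_simple S a0. len R S (s \<circ> w) < len R S w" if "w \<in> W" "len R S w \<noteq> 0" for w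
    using len_descent[OF that] by force
  show "s \<circ> s = id" if "s \<in> refl_of ` aff_simple S a0" for s
    using that aff_simple_nonzero by (auto simp: fun_eq_iff refl_aff_involution)
  show "len R S (s \<circ> w) = Suc (len R S w) \<or> len R S w = Suc (len R S (s \<circ> w))"
    if s: "s \<in> refl_of ` aff_simple S a0" and w: "w \<in> W" for s w
  proof -
    obtain b m where "(b, m) \<in> aff_simple S a0" "s = refl_aff b m" using s by force
    then show ?thesis using len_refl[OF _ w, of b m] by (auto split: if_splits)
  qed
  show "s \<circ> w = w \<circ> t" if "s \<in> refl_of ` aff_simple S a0" "t \<in> refl_of ` aff_simple S a0" "w \<in> W"
    "len R S w < len R S (s \<circ> w)" "len R S (s \<circ> (w \<circ> t)) < len R S (w \<circ> t)" for s t w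
    using that len_folding by auto
qed (use ext_weyl_comp bij_ext_weyl ext_weyl_inv len_inv len_comp_le refl_aff_simple_in
    q_neq_0 q_mult q_len_0 in auto)

lemma chi_iff:
  assumes "j \<in> aff_simple S a0"
  shows "separates (fst j) (snd j) {x} (alcove R S) \<longleftrightarrow> sep (fst j) (snd j) x0 x"
proof -
  have "fst j \<in> R" using assms aff_simple_root by (metis prod.collapse)
  then show ?thesis
    using root_side[OF _ _ x0_alcove] x0_alcove
    by (subst sep_commute, intro separates_iff_sep) (auto intro: sgn_eq_of_mult_pos)
qed

text \<open>A point of the closed alcove is never strictly separated from \<open>x0\<close>, so \<open>v y\<close> and \<open>v x0\<close>
  lie on the same side of a wall unless \<open>v y\<close> is on it; there both branches of \<open>left_op\<close> agree.\<close>

lemma hatT_eq_left_op: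
  assumes j: "j \<in> aff_simple S a0" and y: "y \<in> calcove" and v: "v \<in> W"
  shows "hatT R S q j f (v y) = left_op (refl_of j) (\<lambda>w. f (w y)) v"
proof -
  obtain b m where bm: "j = (b, m)" by fastforce
  have b: "(b, m) \<in> aff_simple S a0" "b \<in> R" "b \<noteq> 0"
    using j bm aff_simple_root aff_simple_nonzero by auto
  have q: "complex_of_real (q (refl_aff b m)) \<noteq> 0" using q_neq_0 refl_aff_simple_in b by auto
  have less: "len R S (refl_aff b m \<circ> v) < len R S v \<longleftrightarrow> sep b m x0 (v x0)"
    using len_refl_less_iff b v by blast
  have chi: "chi R S q j (v y) = (if sep b m x0 (v y) then q (refl_aff b m)
     else if v y \<in> hyperpl b m then 1 else inverse (q (refl_aff b m)))"
    using chi_iff[OF j, of "v y"] by (simp add: chi_def bm)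
  obtain c n where c: "c \<in> R" "carries v c b n" using carries_to v b by blast
  have "\<not> sep b m (v x0) (v y)" using carries_sep[OF c(2)] calcove_not_sep[OF c(1) y] by blast
  moreover have "v x0 \<bullet> coroot b \<noteq> of_int m" "x0 \<bullet> coroot b \<noteq> of_int m"
    using ext_weyl_generic v x0_generic b by blast+
  ultimately have side: "v y \<notin> hyperpl b m \<Longrightarrow> sep b m x0 (v y) = sep b m x0 (v x0)"
    by (auto simp: sep_def hyperpl_def mult_less_0_iff)
  show ?thesis
  proof (cases "v y \<in> hyperpl b m")
    case True
    then have "refl_aff b m (v y) = v y" using refl_aff_fixed_iff b by blast
    then show ?thesis using q by (simp add: hatT_def left_op_def bm algebra_simps)
  next
    case False
    then show ?thesis
      using q side
        by (simp add: hatT_def left_op_def bm[symmetric] chi less algebra_simps) (simp add: bm algebra_simps less)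
  qed
qed

text \<open>Words are lists of maps, while \<open>hatT\<close> is indexed by pairs. The choice of a
  pair is harmless, since \<open>hatT_eq_left_op\<close> expresses \<open>hatT\<close> through the
  reflection alone.\<close>

definition gen_op :: "('a \<Rightarrow> 'a) \<Rightarrow> ('a \<Rightarrow> complex) \<Rightarrow> 'a \<Rightarrow> complex" where
  "gen_op s = hatT R S q (SOME j. j \<in> aff_simple S a0 \<and> refl_of j = s)"

lemma gen_op_obtain:
  assumes "s \<in> refl_of ` aff_simple S a0"
  obtains j where "j \<in> aff_simple S a0" "refl_of j = s" "gen_op s = hatT R S q j"
proof -
  have "\<exists>j. j \<in> aff_simple S a0 \<and> refl_of j = s" using assms by blast
  from someI_ex[OF this] show ?thesis using that gen_op_def by blast
qed

text \<open>A point can be written as \<open>v y\<close> in several ways, so defining the operator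
  orbit by orbit from \<open>Phi\<close> would need a consistency check. A chosen reduced word
  avoids it and makes linearity and stability of \<open>CP R\<close> inductions on the word.\<close>

definition phi :: "('a \<Rightarrow> 'a) \<Rightarrow> ('a \<Rightarrow> complex) \<Rightarrow> 'a \<Rightarrow> complex" where
  "phi w f = (case SOME p. reduced w p of (ss, u) \<Rightarrow> foldr gen_op ss (W_act u f))"

lemma phi_obtain:
  assumes "w \<in> W"
  obtains ss u where "reduced w (ss, u)" "\<And>f. phi w f = foldr gen_op ss (W_act u f)"
proof -
  obtain ss u where p: "(SOME p. reduced w p) = (ss, u)" by fastforce
  have "reduced w (ss, u)" using reduced_some[OF assms] p by simp
  then show ?thesis using that p by (simp add: phi_def)
qed

lemma foldr_gen_op_eq_left_op:
  assumes "y \<in> calcove"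
  shows "set ss \<subseteq> refl_of ` aff_simple S a0 \<Longrightarrow> v \<in> W \<Longrightarrow>
    foldr gen_op ss g (v y) = foldr left_op ss (\<lambda>v. g (v y)) v"
proof (induction ss arbitrary: v)
  case (Cons s ss)
  then have s: "s \<in> refl_of ` aff_simple S a0" by simp
  then obtain j where j: "j \<in> aff_simple S a0" "refl_of j = s" "gen_op s = hatT R S q j"
    by (rule gen_op_obtain)
  have "gen_op s (foldr gen_op ss g) (v y) = left_op s (\<lambda>w. foldr gen_op ss g (w y)) v"
    using hatT_eq_left_op[OF j(1) assms Cons.prems(2)] j by simp
  also have "\<dots> = left_op s (foldr left_op ss (\<lambda>v. g (v y))) v"
    using Cons s by (intro left_op_cong) auto
  finally show ?case by simp
qed simp

text \<open>For a fixed point \<open>y\<close> every factor of the chosen word is intertwined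
  separately; the relations of \<open>Phi\<close> then pass to \<open>phi\<close> without any
  further use of words.\<close>

lemma phi_eq_Phi:
  assumes "w \<in> W" "v \<in> W" "y \<in> calcove"
  shows "phi w f (v y) = Phi w (\<lambda>w. f (w y)) v"
proof -
  obtain ss u where p: "reduced w (ss, u)" "phi w f = foldr gen_op ss (W_act u f)"
    using phi_obtain[OF assms(1)] by metis
  have "set ss \<subseteq> refl_of ` aff_simple S a0" using p by (auto simp: reduced_def)
  then have "phi w f (v y) = foldr left_op ss (\<lambda>v. W_act u f (v y)) v"
    unfolding p(2) using assms by (intro foldr_gen_op_eq_left_op)
  also have "\<dots> = word_op (ss, u) (\<lambda>w. f (w y)) v" by (simp add: word_op_def W_act_def)
  also have "\<dots> = Phi w (\<lambda>w. f (w y)) v" by (rule Phi_eq_word_op[OF p(1) assms(2), symmetric])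
  finally show ?thesis .
qed

lemma eq_on_orbits:
  assumes "\<And>v y. v \<in> W \<Longrightarrow> y \<in> calcove \<Longrightarrow> f (v y) = g (v y)"
  shows "f = g"
proof
  fix x
  obtain v y where "v \<in> W" "y \<in> calcove" "x = v y" using ext_weyl_calcove by blast
  then show "f x = g x" using assms by blast
qed

lemma phi_comp:
  assumes "w \<in> W" "w' \<in> W" "len R S (w \<circ> w') = len R S w + len R S w'"
  shows "phi (w \<circ> w') f = phi w (phi w' f)"
proof (rule eq_on_orbits)
  fix v y assume v: "v \<in> W" "y \<in> calcove"
  have "phi (w \<circ> w') f (v y) = Phi w (Phi w' (\<lambda>w. f (w y))) v"
    using assms v by (simp add: phi_eq_Phi comp_in Phi_comp)
  also have "\<dots> = Phi w (\<lambda>w. phi w' f (w y)) v"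
    using assms v by (intro Phi_cong) (auto simp: phi_eq_Phi)
  also have "\<dots> = phi w (phi w' f) (v y)" using assms v by (simp add: phi_eq_Phi)
  finally show "phi (w \<circ> w') f (v y) = phi w (phi w' f) (v y)" .
qed

lemma phi_refl:
  assumes "j \<in> aff_simple S a0"
  shows "phi (refl_of j) f = hatT R S q j f"
proof (rule eq_on_orbits)
  fix v y assume v: "v \<in> W" "y \<in> calcove"
  have j: "refl_of j \<in> refl_of ` aff_simple S a0" using assms by blast
  show "phi (refl_of j) f (v y) = hatT R S q j f (v y)"
    using v assms by (simp add: phi_eq_Phi gen_in[OF j] Phi_gen[OF j] hatT_eq_left_op)
qed

lemma phi_len0:
  assumes "u \<in> W" "len R S u = 0"
  shows "phi u f = W_act u f"
  by (rule eq_on_orbits) (simp add: assms phi_eq_Phi Phi_len0 W_act_def)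

lemma hatT_quadratic:
  assumes "j \<in> aff_simple S a0"
  shows "hatT R S q j (\<lambda>x. hatT R S q j f x + inverse (complex_of_real (q (refl_of j))) * f x)
    = (\<lambda>x. complex_of_real (q (refl_of j)) * (hatT R S q j f x + inverse (complex_of_real (q (refl_of j))) * f x))"
proof (rule eq_on_orbits)
  let ?q = "complex_of_real (q (refl_of j))"
  fix v y assume v: "v \<in> W" "y \<in> calcove"
  let ?F = "\<lambda>w. f (w y)"
  have j: "refl_of j \<in> refl_of ` aff_simple S a0" using assms by blast
  have "hatT R S q j (\<lambda>x. hatT R S q j f x + inverse ?q * f x) (v y)
      = left_op (refl_of j) (\<lambda>w. hatT R S q j f (w y) + inverse ?q * f (w y)) v"
    using hatT_eq_left_op assms v by simp
  also have "\<dots> = left_op (refl_of j) (\<lambda>w. left_op (refl_of j) ?F w + inverse ?q * ?F w) v"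
    using assms v j by (intro left_op_cong) (auto simp: hatT_eq_left_op)
  also have "\<dots> = ?q * (left_op (refl_of j) ?F v + inverse ?q * ?F v)"
    using left_op_quadratic[OF j] v by simp
  finally show "hatT R S q j (\<lambda>x. hatT R S q j f x + inverse ?q * f x) (v y)
      = ?q * (hatT R S q j f (v y) + inverse ?q * f (v y))"
    using hatT_eq_left_op assms v by simp
qed

section \<open>Stability of C(P) and linearity\<close>

lemma W_act_CP:
  assumes "u \<in> W" "f \<in> CP R"
  shows "W_act u f \<in> CP R"
proof -
  have "inv u x \<notin> weight_lattice R" if "x \<notin> weight_lattice R" for x
    using ext_weyl_weight_lattice[OF assms(1), of "inv u x"] bij_ext_weyl[OF assms(1)] that
    by (auto simp: bij_is_surj surj_f_inv_f)
  then show ?thesis using assms(2) by (simp add: CP_def W_act_def)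
qed

lemma hatT_CP:
  assumes "j \<in> aff_simple S a0" "f \<in> CP R"
  shows "hatT R S q j f \<in> CP R"
proof -
  have j: "refl_of j \<in> refl_of ` aff_simple S a0" using assms by blast
  have "refl_of j x \<notin> weight_lattice R" if "x \<notin> weight_lattice R" for x
    using ext_weyl_weight_lattice[OF gen_in[OF j], of "refl_of j x"] gen_gen[OF j] that
    by (auto simp: fun_eq_iff)
  then show ?thesis using assms(2) by (simp add: CP_def hatT_def)
qed

lemma phi_CP:
  assumes "w \<in> W" "f \<in> CP R"
  shows "phi w f \<in> CP R"
proof -
  obtain ss u where p: "reduced w (ss, u)" "phi w f = foldr gen_op ss (W_act u f)"
    using phi_obtain[OF assms(1)] by metis
  have "foldr gen_op ss g \<in> CP R" if "set ss \<subseteq> refl_of ` aff_simple S a0" "g \<in> CP R" for g ss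
    using that
  proof (induction ss)
    case (Cons s ss)
    then have "s \<in> refl_of ` aff_simple S a0" by simp
    then show ?case using Cons by (elim gen_op_obtain) (auto intro: hatT_CP)
  qed simp
  then show ?thesis using p W_act_CP assms by (auto simp: reduced_def)
qed

lemma phi_linear:
  assumes "w \<in> W"
  shows "phi w (\<lambda>x. c * f x + g x) = (\<lambda>x. c * phi w f x + phi w g x)"
proof -
  obtain ss u where p: "\<And>f. phi w f = foldr gen_op ss (W_act u f)"
    using phi_obtain[OF assms] by metis
  have "foldr gen_op ss (\<lambda>x. c * f x + g x) = (\<lambda>x. c * foldr gen_op ss f x + foldr gen_op ss g x)" for f g
    by (induction ss) (auto simp: gen_op_def hatT_def fun_eq_iff algebra_simps)
  then show ?thesis by (simp add: p W_act_def)
qed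

section \<open>Existence and uniqueness of the representation\<close>

lemma hecke_rep_phi: "hecke_rep R S a0 q phi"
  unfolding hecke_rep_def Let_def
proof (intro conjI ballI allI impI)
  fix j f assume "j \<in> aff_simple S a0"
  then show "phi (refl_of j) (\<lambda>x. phi (refl_of j) f x + inverse (complex_of_real (q (refl_of j))) * f x)
     = (\<lambda>x. complex_of_real (q (refl_of j)) *
         (phi (refl_of j) f x + inverse (complex_of_real (q (refl_of j))) * f x))"
    by (simp add: phi_refl hatT_quadratic)
next
  fix f show "phi id f = f"
    using phi_len0[OF id_in ell_id] by (simp add: W_act_def)
qed (use phi_CP phi_linear phi_comp in blast)+

lemma extends_assignment_phi: "extends_assignment R S a0 q phi"
  using phi_refl phi_len0 by (simp add: extends_assignment_def Omega_iff)

lemma phi_unique: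
  assumes "hecke_rep R S a0 q \<psi>" "extends_assignment R S a0 q \<psi>" "f \<in> CP R"
  shows "w \<in> W \<Longrightarrow> \<psi> w f = phi w f"
proof (induction "len R S w" arbitrary: w rule: less_induct)
  case less
  show ?case
  proof (cases "len R S w = 0")
    case True
    then show ?thesis
      using assms less phi_len0 by (simp add: extends_assignment_def Omega_iff)
  next
    case False
    then obtain s where s: "s \<in> refl_of ` aff_simple S a0" "len R S (s \<circ> w) < len R S w"
      using descent less by blast
    obtain j where j: "j \<in> aff_simple S a0" "s = refl_of j" using s by blast
    define w' where "w' = s \<circ> w"
    have w': "w' \<in> W" "w = s \<circ> w'" "len R S w' < len R S w"
      using s less by (auto simp: w'_def comp_in gen_in gen_cancel)
    have l: "len R S (s \<circ> w') = len R S s + len R S w'"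
      using ell_gen_comp[OF s(1) w'(1)] w' ell_gen[OF s(1)] by auto
    have "\<psi> (s \<circ> w') f = \<psi> s (\<psi> w' f)"
      using assms(1,3) gen_in[OF s(1)] w'(1) l unfolding hecke_rep_def by blast
    also have "\<dots> = \<psi> s (phi w' f)" using less.hyps w' by simp
    \<comment> \<open>The assignment prescribes \<open>\<psi> s\<close> on \<open>CP R\<close> only,
      so \<open>phi w' f\<close> must be known to lie there.\<close>
    also have "\<dots> = hatT R S q j (phi w' f)"
      using assms(2) j phi_CP[OF w'(1) assms(3)] by (simp add: extends_assignment_def)
    also have "\<dots> = phi s (phi w' f)" using phi_refl j by simp
    also have "\<dots> = phi (s \<circ> w') f" using phi_comp[OF gen_in[OF s(1)] w'(1) l] by simp
    finally show ?thesis using w'(2) by simp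
  qed
qed

end

theorem mainTheorem1:
  fixes R S :: "'a::euclidean_space set" and a0 :: 'a and q :: "('a \<Rightarrow> 'a) \<Rightarrow> real"
  assumes "root_system R"
    and "is_base R S"
    and "highest_coroot_root R S a0"
    and "\<forall>w\<in>ext_weyl R. q w \<noteq> 0"
    and "\<forall>w\<in>ext_weyl R. \<forall>w'\<in>ext_weyl R.
           len R S (w \<circ> w') = len R S w + len R S w' \<longrightarrow> q (w \<circ> w') = q w * q w'"
    and "\<forall>w\<in>ext_weyl R. len R S w = 0 \<longrightarrow> q w = 1"
  shows "\<exists>\<phi>. hecke_rep R S a0 q \<phi> \<and> extends_assignment R S a0 q \<phi> \<and>
           (\<forall>\<psi>. hecke_rep R S a0 q \<psi> \<and> extends_assignment R S a0 q \<psi> \<longrightarrow>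
                 (\<forall>w\<in>ext_weyl R. \<forall>f\<in>CP R. \<psi> w f = \<phi> w f))"
proof -
  interpret hecke_datum R S a0 q
    using assms by unfold_locales auto
  show ?thesis
    using hecke_rep_phi extends_assignment_phi phi_unique by (intro exI[of _ phi]) blast
qed

end
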